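(* Let $\Pi\in\mathbb{C}^{n\times n}$ be a nonnegative self-adjoint solution of the control algebraic Riccati equation $$A_d^*\Pi A_d-\Pi+C_d^*C_d=V^*P^{-1}V,\qquad P:=I+D_d^*D_d+B_d^*\Pi B_d,\quad V:=D_d^*C_d+B_d^*\Pi A_d .$$ Let $Z:=\Pi I_X$, i.e. $(Zz)(\zeta)=\Pi z(\zeta)$ for $z\in X$, and let $\Omega:=P^{\frac12}$. With the operators $A,C,D$ and the Yosida extension $B_\omega^*$ of $B^*$ described in the context, the operator Riccati equation $$\langle Az,Zz\rangle_X+\langle Zz,Az\rangle_X+\langle Cz,Cz\rangle_Y=\left\langle(\Omega^*\Omega)^{-1}(B_\omega^*Z+D^*C)z,(B_\omega^*Z+D^*C)z\right\rangle_U$$ holds for all $z\in D(A)$.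
   Context: Let $n,p,m$ be positive integers with $p\le n$, and let $\lambda_0:[0,1]\to\mathbb{R}$ be a bounded measurable function with $\lambda_0(\cdot)\ge\epsilon>0$ for some constant $\epsilon$. Let $X:=\mathrm{L}^2(0,1;\mathbb{C}^n)$ with inner product $\langle f,g\rangle_X:=\int_0^1 g^*(\zeta)\lambda_0(\zeta)f(\zeta)\,\mathrm{d}\zeta$, and let $U:=\mathbb{C}^p$, $Y:=\mathbb{C}^m$ with their standard inner products. Let $K,L\in\mathbb{C}^{n\times n}$ and $K_y,L_y\in\mathbb{C}^{m\times n}$ be matrices with $K$ invertible. They define the boundary controlled and observed PDE $\partial_t z=-\partial_\zeta(\lambda_0z)$ on $[0,1]$ with $\left[\begin{smallmatrix}0\\ I\end{smallmatrix}\right]u(t)=-K\lambda_0(0)z(0,t)-L\lambda_0(1)z(1,t)$ and $y(t)=-K_y\lambda_0(0)z(0,t)-L_y\lambda_0(1)z(1,t)$. Here $\left[\begin{smallmatrix}0\\ I\end{smallmatrix}\right]\in\mathbb{C}^{n\times p}$ has the $p\times p$ identity as its last $p$ rows. Set $$A_d:=-K^{-1}L,\quad B_d:=-K^{-1}\left[\begin{smallmatrix}0\\ I\end{smallmatrix}\right],\quad C_d:=K_yK^{-1}L-L_y,\quad D_d:=K_yK^{-1}\left[\begin{smallmatrix}0\\ I\end{smallmatrix}\right].$$ The operators associated with this system are as follows. Point values of $\lambda_0z$ are those of its continuous representative when $\lambda_0 z\in\mathrm{H}^1$. - $A:D(A)\subset X\to X$, $Az=-\frac{\mathrm{d}}{\mathrm{d}\zeta}(\lambda_0z)$,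 $D(A)=\{z\in X:\lambda_0z\in\mathrm{H}^1(0,1;\mathbb{C}^n),\ (\lambda_0z)(0)-A_d(\lambda_0z)(1)=0\}$. - Its adjoint $A^*z=\frac{\mathrm{d}}{\mathrm{d}\zeta}(\lambda_0z)$, $D(A^* )=\{z\in X:\lambda_0z\in\mathrm{H}^1(0,1;\mathbb{C}^n),\ (\lambda_0z)(1)-A_d^*(\lambda_0z)(0)=0\}$. - The adjoint of the control operator: $B^*:D(A^* )\to U$, $B^*\psi=B_d^*(\lambda_0\psi)(0)$. - The output operator $C:D(A)\to Y$, $Cz=C_d(\lambda_0z)(1)$. - The feedthrough operator $D:U\to Y$, $Du=D_du$. - The Yosida extension $B_\omega^*$ of $B^*$: $B_\omega^*g:=\lim_{s\to\infty,\,s\in\mathbb{R}}B^*s(sI-A^* )^{-1}g$, defined for those $g\in X$ for which the limit exists. Its domain contains every $g\in X$ for which $\lambda_0g$ admits a right limit at $0$, and for such $g$ it is given by $B_\omega^*g=B_d^*(\lambda_0g)(0^+)$. "Nonnegative" means positive semidefinite Hermitian. *)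

theory Defs
  imports "HOL-Analysis.Analysis"
begin

section \<open>Complex matrices\<close>

text \<open>Linear in the first argument: the product of \<^term>\<open>x\<close> and \<^term>\<open>y\<close> is $y^* x$.\<close>

definition cinner :: "complex^'n \<Rightarrow> complex^'n \<Rightarrow> complex"
  where "cinner x y = (\<Sum>i\<in>UNIV. cnj (y $ i) * x $ i)"

definition ctranspose :: "complex^'n^'m \<Rightarrow> complex^'m^'n"
  where "ctranspose M = (\<chi> i j. cnj (M $ j $ i))"

definition psd :: "complex^'n^'n \<Rightarrow> bool"
  where "psd M \<longleftrightarrow> ctranspose M = M \<and> (\<forall>x. 0 \<le> Re (cinner (M *v x) x))"

definition psd_sqrt :: "complex^'n^'n \<Rightarrow> complex^'n^'n"
  where "psd_sqrt M = (THE S. psd S \<and> S ** S = M)"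

text \<open>
  The block matrix with the identity in its last rows. Matching rows and columns by their
  distance from the end places the identity there whenever \<open>CARD('p) \<le> CARD('n)\<close>.
\<close>

definition zero_id :: "complex^'p::{finite,linorder}^'n::{finite,linorder}"
  where "zero_id = (\<chi> i j. if card {k. i < k} = card {k. j < k} then 1 else 0)"


section \<open>Function spaces on the unit interval\<close>

text \<open>
  Elements of $L^2$ are represented by functions; equality in $L^2$ is equality almost everywhere.
  Values outside the unit interval are irrelevant.
\<close>

abbreviation unit_leb :: "real measure"
  where "unit_leb \<equiv> lebesgue_on {0..1}"

definition L2 :: "(real \<Rightarrow> complex^'n) set"
  where "L2 = {f \<in> borel_measurable unit_leb. integrable unit_leb (\<lambda>x. (norm (f x))\<^sup>2)}"

definition inner_X :: "(real \<Rightarrow> real) \<Rightarrow> (real \<Rightarrow> complex^'n) \<Rightarrow> (real \<Rightarrow> complex^'n) \<Rightarrow> complex"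
  where "inner_X lam f g = (LINT x|unit_leb. cinner (lam x *\<^sub>R f x) (g x))"

text \<open>Continuously differentiable functions with compact support in the open unit interval.\<close>

definition C1c :: "(real \<Rightarrow> real) set"
  where "C1c = {\<phi>. (\<forall>x. \<phi> differentiable (at x)) \<and> continuous_on UNIV (deriv \<phi>) \<and>
    (\<exists>a b. 0 < a \<and> b < 1 \<and> (\<forall>x. x \<notin> {a..b} \<longrightarrow> \<phi> x = 0))}"

definition is_weak_deriv :: "(real \<Rightarrow> complex^'n) \<Rightarrow> (real \<Rightarrow> complex^'n) \<Rightarrow> bool"
  where "is_weak_deriv u v \<longleftrightarrow>
    (\<forall>\<phi>\<in>C1c. (LINT x|unit_leb. deriv \<phi> x *\<^sub>R u x) = - (LINT x|unit_leb. \<phi> x *\<^sub>R v x))"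

definition H1 :: "(real \<Rightarrow> complex^'n) set"
  where "H1 = {u \<in> L2. \<exists>v\<in>L2. is_weak_deriv u v}"

text \<open>
  For \<open>u \<in> H1\<close> the following two functions are determined up to null sets and on the unit
  interval, respectively.
\<close>

definition weak_deriv :: "(real \<Rightarrow> complex^'n) \<Rightarrow> real \<Rightarrow> complex^'n"
  where "weak_deriv u = (SOME v. v \<in> L2 \<and> is_weak_deriv u v)"

definition cont_rep :: "(real \<Rightarrow> complex^'n) \<Rightarrow> real \<Rightarrow> complex^'n"
  where "cont_rep u = (SOME w. continuous_on {0..1} w \<and> (AE x in unit_leb. w x = u x))"


section \<open>Operators of the boundary controlled system\<close>

definition scaled :: "(real \<Rightarrow> real) \<Rightarrow> (real \<Rightarrow> complex^'n) \<Rightarrow> real \<Rightarrow> complex^'n"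
  where "scaled lam z = (\<lambda>x. lam x *\<^sub>R z x)"

definition dom_A :: "(real \<Rightarrow> real) \<Rightarrow> complex^'n^'n \<Rightarrow> (real \<Rightarrow> complex^'n) set"
  where "dom_A lam Ad = {z \<in> L2. scaled lam z \<in> H1 \<and>
    cont_rep (scaled lam z) 0 - Ad *v cont_rep (scaled lam z) 1 = 0}"

definition op_A :: "(real \<Rightarrow> real) \<Rightarrow> (real \<Rightarrow> complex^'n) \<Rightarrow> real \<Rightarrow> complex^'n"
  where "op_A lam z = (\<lambda>x. - weak_deriv (scaled lam z) x)"

definition dom_A_adj :: "(real \<Rightarrow> real) \<Rightarrow> complex^'n^'n \<Rightarrow> (real \<Rightarrow> complex^'n) set"
  where "dom_A_adj lam Ad = {z \<in> L2. scaled lam z \<in> H1 \<and>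
    cont_rep (scaled lam z) 1 - ctranspose Ad *v cont_rep (scaled lam z) 0 = 0}"

definition op_A_adj :: "(real \<Rightarrow> real) \<Rightarrow> (real \<Rightarrow> complex^'n) \<Rightarrow> real \<Rightarrow> complex^'n"
  where "op_A_adj lam z = weak_deriv (scaled lam z)"

definition op_B_adj ::
    "(real \<Rightarrow> real) \<Rightarrow> complex^'p^'n \<Rightarrow> (real \<Rightarrow> complex^'n) \<Rightarrow> complex^'p"
  where "op_B_adj lam Bd \<psi> = ctranspose Bd *v cont_rep (scaled lam \<psi>) 0"

definition op_C :: "(real \<Rightarrow> real) \<Rightarrow> complex^'n^'m \<Rightarrow> (real \<Rightarrow> complex^'n) \<Rightarrow> complex^'m"
  where "op_C lam Cd z = Cd *v cont_rep (scaled lam z) 1"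

definition op_Z :: "complex^'n^'n \<Rightarrow> (real \<Rightarrow> complex^'n) \<Rightarrow> real \<Rightarrow> complex^'n"
  where "op_Z PI z = (\<lambda>x. PI *v z x)"

text \<open>
  The resolvent $(sI - A^*)^{-1}$ applied to \<^term>\<open>g\<close>. For \<^term>\<open>s\<close> in the resolvent set the
  equation has exactly one solution up to null sets; this covers all large real \<^term>\<open>s\<close>, and
  only these enter the limit below.
\<close>

definition resolvent_A_adj ::
    "(real \<Rightarrow> real) \<Rightarrow> complex^'n^'n \<Rightarrow> real \<Rightarrow> (real \<Rightarrow> complex^'n) \<Rightarrow> real \<Rightarrow> complex^'n"
  where "resolvent_A_adj lam Ad s g = (SOME \<psi>. \<psi> \<in> dom_A_adj lam Ad \<and>
    (AE x in unit_leb. s *\<^sub>R \<psi> x - op_A_adj lam \<psi> x = g x))"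

definition yosida_approx ::
    "(real \<Rightarrow> real) \<Rightarrow> complex^'n^'n \<Rightarrow> complex^'p^'n \<Rightarrow> (real \<Rightarrow> complex^'n) \<Rightarrow> real \<Rightarrow> complex^'p"
  where "yosida_approx lam Ad Bd g s = op_B_adj lam Bd (\<lambda>x. s *\<^sub>R resolvent_A_adj lam Ad s g x)"

definition dom_B_omega_adj ::
    "(real \<Rightarrow> real) \<Rightarrow> complex^'n^'n \<Rightarrow> complex^'p^'n \<Rightarrow> (real \<Rightarrow> complex^'n) set"
  where "dom_B_omega_adj lam Ad Bd =
    {g \<in> L2. \<exists>b. (yosida_approx lam Ad Bd g \<longlongrightarrow> b) at_top}"

definition op_B_omega_adj ::
    "(real \<Rightarrow> real) \<Rightarrow> complex^'n^'n \<Rightarrow> complex^'p^'n \<Rightarrow> (real \<Rightarrow> complex^'n) \<Rightarrow> complex^'p"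
  where "op_B_omega_adj lam Ad Bd g = Lim at_top (yosida_approx lam Ad Bd g)"

end

(*
  In terms of w = lam z, continuous after modification on a null set, and its derivative w',
  the left-hand side is minus the integral of (w* PI w)' plus |C_d w(1)|^2. With the boundary
  condition w(0) = A_d w(1) it equals w(1)* (A_d* PI A_d - PI + C_d* C_d) w(1), and the matrix
  Riccati equation applies. The right-hand side reduces to the same expression once the Yosida
  extension is known to evaluate at 0: for the solution psi of s psi - A* psi = g, the function
  phi = lam psi solves phi' = (s / lam) phi - g, so s phi(0) is, up to exponentially small terms, a
  Laplace transform of lam g along the travel time, the integral of 1 / lam; it tends to the value
  of lam g at 0 as s tends to infinity.
*)
theory Submission
  imports Defs
begin

section \<open>Absolutely continuous functions on the unit interval\<close>

text \<open>The obstacle is regularity. \<open>lam\<close> is only measurable, so the differential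
  equations hold almost everywhere at best, and the calculus has to run through integrals:
  \<open>AC\<close> pairs a function with a density for its increments, and product and chain rules
  are derived for such pairs from estimates on short intervals. The bridge to the weak derivatives
  of the definitions is the du Bois-Reymond lemma. A second obstacle is choice. Weak derivative,
  continuous representative and resolvent are arbitrary choices among admissible objects, so each
  needs a candidate and a proof that the quantity read off does not depend on the choice. For the
  resolvent this is an equation for the trace at 0 that every solution satisfies.
  \<open>psd_sqrt\<close> is a definite description, hence both existence and uniqueness of the
  square root are established, the former from compactness, the latter from a trace identity. The
  limit in the Yosida extension cannot be bypassed: \<open>op_Z PI z\<close> need not satisfy the
  boundary condition of the adjoint, so it may lie outside the domain of the adjoint control
  operator.\<close>

lemma AE_eq_zero_of_integral_Icc_eq_zero:
  fixes f :: "real \<Rightarrow> 'a::euclidean_space"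
  assumes f: "f absolutely_integrable_on {a..b}"
    and zero: "\<And>c d. a \<le> c \<Longrightarrow> c \<le> d \<Longrightarrow> d \<le> b \<Longrightarrow> integral {c..d} f = 0"
  shows "AE x in lebesgue_on {a..b}. f x = 0"
proof -
  have int: "f integrable_on cbox a b"
    using f by (simp add: set_lebesgue_integral_eq_integral(1))
  have "((\<lambda>x. norm (f x)) has_integral 0) (cbox a b)"
    unfolding has_integral
  proof (intro allI impI)
    fix e :: real
    assume "e > 0"
    \<comment> \<open>Since \<open>f\<close> has integral 0 over every interval, the sum controlled
      by Henstock's lemma is itself the Riemann sum of the norm, so \<open>norm (f x)\<close> has
      integral 0.\<close>
    obtain \<gamma> where \<gamma>: "gauge \<gamma>"
      "\<And>p. p tagged_partial_division_of (cbox a b) \<Longrightarrow> \<gamma> fine p \<Longrightarrow>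
        (\<Sum>(x,k)\<in>p. norm (measure lborel k *\<^sub>R f x - integral k f)) < e"
      using Henstock_lemma[OF int \<open>e > 0\<close>] by blast
    have "norm ((\<Sum>(x,k)\<in>p. measure lborel k *\<^sub>R norm (f x)) - 0) < e"
      if p: "p tagged_division_of (cbox a b)" "\<gamma> fine p" for p
    proof -
      have "(\<Sum>(x,k)\<in>p. measure lborel k *\<^sub>R norm (f x)) = (\<Sum>(x,k)\<in>p. norm (measure lborel k *\<^sub>R f x - integral k f))"
      proof (rule sum.cong[OF refl], clarify)
        fix x k
        assume "(x,k) \<in> p"
        with p obtain c d where k: "k = cbox c d" "k \<subseteq> cbox a b"
          by (meson tagged_division_ofD(3,4))
        have "integral k f = 0"
        proof (cases "c \<le> d")
          case True
          with k show ?thesis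
            by (auto intro!: zero)
        qed (use k in auto)
        then show "measure lborel k *\<^sub>R norm (f x) = norm (measure lborel k *\<^sub>R f x - integral k f)"
          by simp
      qed
      moreover have "\<dots> < e"
        using \<gamma>(2)[OF p(1)[unfolded tagged_division_of_def, THEN conjunct1] p(2)] .
      moreover have "0 \<le> (\<Sum>(x,k)\<in>p. measure lborel k *\<^sub>R norm (f x))"
        by (intro sum_nonneg) auto
      ultimately show ?thesis
        by simp
    qed
    with \<gamma>(1) show "\<exists>\<gamma>. gauge \<gamma> \<and> (\<forall>\<D>. \<D> tagged_division_of cbox a b \<and> \<gamma> fine \<D> \<longrightarrow>
        norm ((\<Sum>(x, k)\<in>\<D>. measure lborel k *\<^sub>R norm (f x)) - 0) < e)"
      by (intro exI[of _ \<gamma>]) simp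
  qed
  then have "integral {a..b} (\<lambda>x. norm (f x)) = 0"
    by (simp add: integral_unique)
  moreover have int_norm: "integrable (lebesgue_on {a..b}) (\<lambda>x. norm (f x))"
    using f by (simp add: absolutely_integrable_measurable o_def)
  ultimately have "integral\<^sup>L (lebesgue_on {a..b}) (\<lambda>x. norm (f x)) = 0"
    by (simp add: lebesgue_integral_eq_integral)
  then show ?thesis
    using integral_nonneg_eq_0_iff_AE[OF int_norm] by simp
qed

text \<open>
  \<open>AC w v\<close>: on the unit interval \<open>w\<close> is absolutely continuous with derivative \<open>v\<close> almost everywhere.
\<close>

definition AC :: "(real \<Rightarrow> 'a::euclidean_space) \<Rightarrow> (real \<Rightarrow> 'a) \<Rightarrow> bool"
  where "AC w v \<longleftrightarrow> v absolutely_integrable_on {0..1} \<and>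
    (\<forall>x\<in>{0..1}. w x - w 0 = integral {0..x} v)"

lemma AC_integrable: "AC w v \<Longrightarrow> v absolutely_integrable_on {0..1}"
  by (simp add: AC_def)

lemma abs_integrable_sub:
  fixes v :: "real \<Rightarrow> 'a::euclidean_space"
  shows "v absolutely_integrable_on {0..1} \<Longrightarrow> 0 \<le> a \<Longrightarrow> b \<le> 1 \<Longrightarrow> v absolutely_integrable_on {a..b}"
  by (rule absolutely_integrable_on_subinterval) auto

lemma abs_integrable_imp_integrable_sub:
  fixes v :: "real \<Rightarrow> 'a::euclidean_space"
  shows "v absolutely_integrable_on {0..1::real} \<Longrightarrow> 0 \<le> a \<Longrightarrow> b \<le> 1 \<Longrightarrow> v integrable_on {a..b}"
  using abs_integrable_sub set_lebesgue_integral_eq_integral(1) by blast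

lemma AC_diff:
  assumes "AC w v" "0 \<le> a" "a \<le> b" "b \<le> 1"
  shows "w b - w a = integral {a..b} v"
proof -
  have "integral {0..a} v + integral {a..b} v = integral {0..b} v"
    using assms abs_integrable_imp_integrable_sub[OF AC_integrable[OF assms(1)]]
    by (intro Henstock_Kurzweil_Integration.integral_combine) auto
  moreover have "w a - w 0 = integral {0..a} v" "w b - w 0 = integral {0..b} v"
    using assms unfolding AC_def by auto
  ultimately show ?thesis
    by (metis add_diff_cancel_left' diff_diff_eq2 diff_add_cancel)
qed

lemma AC_continuous_on:
  assumes "AC w v"
  shows "continuous_on {0..1} w"
proof -
  have "continuous_on {0..1} (\<lambda>x. w 0 + integral {0..x} v)"
    using assms abs_integrable_imp_integrable_sub[of v 0 1]
    by (intro continuous_intros indefinite_integral_continuous_1) (auto simp: AC_def)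
  moreover have "w 0 + integral {0..x} v = w x" if "x \<in> {0..1}" for x
    using AC_diff[OF assms, of 0 x] that by (simp add: algebra_simps)
  ultimately show ?thesis
    by (rule continuous_on_eq)
qed

lemma AC_I:
  assumes "v absolutely_integrable_on {0..1}"
  shows "AC (\<lambda>x. c + integral {0..x} v) v"
  using assms by (auto simp: AC_def)

lemma AC_cong:
  assumes "AC w v" "\<And>x. x \<in> {0..1} \<Longrightarrow> w' x = w x"
  shows "AC w' v"
  using assms by (simp add: AC_def)

lemma AC_AE_cong:
  assumes "AC w v" "AE x in unit_leb. v x = v' x" "v' \<in> borel_measurable unit_leb"
  shows "AC w v'"
proof -
  have neg: "negligible {x \<in> {0..1}. v x \<noteq> v' x}"
    using assms(2) 
    by (auto simp: AE_restrict_space_iff negligible_iff_null_sets completion.AE_iff_null_sets)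
  have "v' absolutely_integrable_on {0..1}"
    using absolutely_integrable_spike[OF AC_integrable[OF assms(1)] neg] by auto
  moreover have "integral {0..x} v = integral {0..x} v'" if "x \<in> {0..1}" for x
    using that by (intro integral_spike[OF neg]) auto
  ultimately show ?thesis
    using assms(1) by (auto simp: AC_def)
qed

text \<open>The error bound is additive over adjacent intervals, so Bolzano's bisection principle
  spreads it from short intervals to all of \<open>{0..x}\<close>; letting \<open>e\<close> tend to
  0 removes the error. The factor \<open>integral {a..b} m\<close> permits the summation: a bare
  bound \<open>e\<close> per piece would grow with the number of pieces.\<close>

lemma AC_I_local:
  fixes F f :: "real \<Rightarrow> 'a::euclidean_space" and m :: "real \<Rightarrow> real"
  assumes f: "f absolutely_integrable_on {0..1}" and m: "m absolutely_integrable_on {0..1}"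
    and loc: "\<And>x e. 0 \<le> x \<Longrightarrow> x \<le> 1 \<Longrightarrow> e > 0 \<Longrightarrow> \<exists>d>0. \<forall>a b. 0 \<le> a \<and> a \<le> x \<and> x \<le> b \<and> b \<le> 1 \<and> b - a < d
      \<longrightarrow> norm (F b - F a - integral {a..b} f) \<le> e * integral {a..b} m"
  shows "AC F f"
proof -
  have bound: "norm (F x - F 0 - integral {0..x} f) \<le> e * integral {0..x} m"
    if "0 \<le> x" "x \<le> 1" "e > 0" for x e
  proof -
    \<comment> \<open>The guards \<open>0 \<le> a\<close> and \<open>b \<le> 1\<close> sit inside
      \<open>Q\<close> because Bolzano's principle ranges over all real intervals, including those
      that leave the unit interval.\<close>
    define Q where "Q = (\<lambda>a b. 0 \<le> a \<and> b \<le> 1 \<longrightarrow> norm (F b - F a - integral {a..b} f) \<le> e * integral {a..b} m)"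
    from \<open>0 \<le> x\<close> have "Q 0 x"
    proof (induction rule: Bolzano)
      case (trans a b c)
      have "norm (F c - F a - integral {a..c} f) \<le> e * integral {a..c} m" if "0 \<le> a" "c \<le> 1"
      proof -
        have f: "integral {a..c} f = integral {a..b} f + integral {b..c} f"
          using trans that abs_integrable_imp_integrable_sub[OF f]
          by (intro Henstock_Kurzweil_Integration.integral_combine[symmetric]; simp)
        have m: "integral {a..c} m = integral {a..b} m + integral {b..c} m"
          using trans that abs_integrable_imp_integrable_sub[OF m]
          by (intro Henstock_Kurzweil_Integration.integral_combine[symmetric]; simp)
        have "norm (F c - F a - integral {a..c} f)
            = norm ((F b - F a - integral {a..b} f) + (F c - F b - integral {b..c} f))"
          unfolding f by (simp add: algebra_simps)
        also have "\<dots> \<le> norm (F b - F a - integral {a..b} f) + norm (F c - F b - integral {b..c} f)"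
          by (rule norm_triangle_ineq)
        also have "\<dots> \<le> e * integral {a..b} m + e * integral {b..c} m"
          using trans(1,2)[unfolded Q_def] trans(3,4) that by (intro add_mono) linarith+
        finally show ?thesis
          unfolding m by (simp only: distrib_left)
      qed
      then show ?case
        by (simp add: Q_def)
    next
      case (local y)
      then have y: "0 \<le> y" "y \<le> 1"
        using that by simp_all
      from loc[OF y \<open>e > 0\<close>] obtain d where "d > 0"
        "\<And>a b. 0 \<le> a \<Longrightarrow> a \<le> y \<Longrightarrow> y \<le> b \<Longrightarrow> b \<le> 1 \<Longrightarrow> b - a < d
          \<Longrightarrow> norm (F b - F a - integral {a..b} f) \<le> e * integral {a..b} m"
        by blast
      then show ?case
        by (intro exI[of _ d]) (simp add: Q_def)
    qed
    with that show ?thesis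
      by (simp add: Q_def)
  qed
  have "F x - F 0 = integral {0..x} f" if "x \<in> {0..1}" for x
  proof -
    have "norm (F x - F 0 - integral {0..x} f) \<le> 0"
    proof (rule field_le_epsilon)
      fix e :: real
      assume "e > 0"
      \<comment> \<open>The added 1 keeps the divisor positive when the integral of \<open>m\<close>
        vanishes.\<close>
      have "integral {0..x} m \<le> \<bar>integral {0..x} m\<bar> + 1"
        by simp
      then have "e / (\<bar>integral {0..x} m\<bar> + 1) * integral {0..x} m \<le> e / (\<bar>integral {0..x} m\<bar> + 1) * (\<bar>integral {0..x} m\<bar> + 1)"
        using \<open>e > 0\<close> by (intro mult_left_mono) auto
      also have "\<dots> = e"
        by (smt (verit) nonzero_eq_divide_eq)
      finally show "norm (F x - F 0 - integral {0..x} f) \<le> 0 + e"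
        using bound[of x "e / (\<bar>integral {0..x} m\<bar> + 1)"] that \<open>e > 0\<close> by fastforce
    qed
    then show ?thesis
      by simp
  qed
  with f show ?thesis
    by (simp add: AC_def)
qed

section \<open>Linear, product and chain rules for \<open>AC\<close>\<close>

lemma AC_linear:
  assumes "AC w v" "linear h"
  shows "AC (\<lambda>x. h (w x)) (\<lambda>x. h (v x))"
proof -
  have "integral {0..x} (\<lambda>x. h (v x)) = h (integral {0..x} v)" if "x \<in> {0..1}" for x
    using integral_linear[of v "{0..x}" h] abs_integrable_imp_integrable_sub[OF AC_integrable[OF assms(1)]] that
      linear_conv_bounded_linear assms(2) by (fastforce simp: o_def)
  moreover have "(\<lambda>x. h (v x)) absolutely_integrable_on {0..1}"
    using absolutely_integrable_linear[OF AC_integrable[OF assms(1)]] assms(2)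
      linear_conv_bounded_linear by (fastforce simp: o_def)
  ultimately show ?thesis
    using assms(1) by (simp add: AC_def linear_diff[OF assms(2), symmetric])
qed

lemma AC_minus:
  "AC w v \<Longrightarrow> AC (\<lambda>x. - w x) (\<lambda>x. - v x)"
  using AC_linear[of w v uminus] by (simp add: linear_iff)

lemma abs_integrable_continuous_bilinear:
  fixes h :: "'a::euclidean_space \<Rightarrow> 'b::euclidean_space \<Rightarrow> 'c::euclidean_space"
  assumes "bounded_bilinear h" "continuous_on {0..1::real} f" "g absolutely_integrable_on {0..1}"
  shows "(\<lambda>x. h (f x) (g x)) absolutely_integrable_on {0..1}"
proof (rule absolutely_integrable_bounded_measurable_product[where h = h and f = f and g = g])
  show "bilinear h"
    using assms(1) by (simp add: bilinear_conv_bounded_bilinear)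
  show "f \<in> borel_measurable unit_leb"
    using assms(2) by (rule continuous_imp_measurable_on_sets_lebesgue) simp
  show "bounded (f ` {0..1})"
    using assms(2) by (intro compact_imp_bounded compact_continuous_image compact_Icc)
qed (use assms(3) in simp_all)

lemma AC_bilinear:
  fixes h :: "'a::euclidean_space \<Rightarrow> 'b::euclidean_space \<Rightarrow> 'c::euclidean_space"
  assumes h: "bounded_bilinear h" and F: "AC F f" and G: "AC G g"
  shows "AC (\<lambda>x. h (F x) (G x)) (\<lambda>x. h (f x) (G x) + h (F x) (g x))"
proof -
  interpret h: bounded_bilinear h by (rule h)
  obtain B where B: "B > 0" "\<And>x y. norm (h x y) \<le> norm x * norm y * B"
    using h.pos_bounded by blast
  note intf = AC_integrable[OF F] and intg = AC_integrable[OF G]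
  have int1: "(\<lambda>x. h (f x) (G x)) absolutely_integrable_on {0..1}"
    using abs_integrable_continuous_bilinear[OF h.flip AC_continuous_on[OF G] intf] .
  have int2: "(\<lambda>x. h (F x) (g x)) absolutely_integrable_on {0..1}"
    using abs_integrable_continuous_bilinear[OF h AC_continuous_on[OF F] intg] .
  show ?thesis
  proof (rule AC_I_local[where m = "\<lambda>x. norm (f x) + norm (g x)"])
    show "(\<lambda>x. h (f x) (G x) + h (F x) (g x)) absolutely_integrable_on {0..1}"
      using int1 int2 by (rule set_integral_add)
    show "(\<lambda>x. norm (f x) + norm (g x)) absolutely_integrable_on {0..1}"
      using intf intg by (intro set_integral_add absolutely_integrable_norm[unfolded o_def])
  next
    fix x e :: real
    assume x: "0 \<le> x" "x \<le> 1" and e: "e > 0"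
    \<comment> \<open>\<open>F\<close> and \<open>G\<close> stay within \<open>e'\<close> of their
      values at \<open>x\<close>, hence oscillate by at most \<open>2 * e'\<close> on the interval;
      the bound \<open>B\<close> of \<open>h\<close> turns this into
      \<open>2 * e' * B = e\<close>.\<close>
    define e' where "e' = e / (2 * B)"
    have e': "e' > 0"
      using e B by (simp add: e'_def)
    have eB: "e = 2 * e' * B"
      using B(1) by (simp add: e'_def)
    obtain d1 where d1: "d1 > 0" "\<And>y. y \<in> {0..1} \<Longrightarrow> \<bar>y - x\<bar> < d1 \<Longrightarrow> norm (F y - F x) < e'"
      using AC_continuous_on[OF F] x e' unfolding continuous_on_iff dist_norm by (metis atLeastAtMost_iff real_norm_def)
    obtain d2 where d2: "d2 > 0" "\<And>y. y \<in> {0..1} \<Longrightarrow> \<bar>y - x\<bar> < d2 \<Longrightarrow> norm (G y - G x) < e'"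
      using AC_continuous_on[OF G] x e' unfolding continuous_on_iff dist_norm by (metis atLeastAtMost_iff real_norm_def)
    have "norm (h (F b) (G b) - h (F a) (G a) - integral {a..b} (\<lambda>x. h (f x) (G x) + h (F x) (g x)))
        \<le> e * integral {a..b} (\<lambda>x. norm (f x) + norm (g x))"
      if ab: "0 \<le> a" "a \<le> x" "x \<le> b" "b \<le> 1" "b - a < min d1 d2" for a b
    proof -
      have i1: "(f has_integral (F b - F a)) {a..b}" "(g has_integral (G b - G a)) {a..b}"
        using AC_diff[OF F, of a b] AC_diff[OF G, of a b] ab abs_integrable_imp_integrable_sub[OF intf, of a b]
          abs_integrable_imp_integrable_sub[OF intg, of a b] by (simp_all add: has_integral_iff)
      have i2: "((\<lambda>t. h (f t) (G b)) has_integral h (F b - F a) (G b)) {a..b}"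
        "((\<lambda>t. h (F a) (g t)) has_integral h (F a) (G b - G a)) {a..b}"
        using has_integral_linear[OF i1(1) h.bounded_linear_left[of "G b"]]
          has_integral_linear[OF i1(2) h.bounded_linear_right[of "F a"]] by (simp_all add: o_def)
      define r where "r = (\<lambda>t. (h (f t) (G b) + h (F a) (g t)) - (h (f t) (G t) + h (F t) (g t)))"
      have i3: "(\<lambda>t. h (f t) (G t) + h (F t) (g t)) integrable_on {a..b}"
        using ab by (intro integrable_add abs_integrable_imp_integrable_sub int1 int2)
      have i4: "(r has_integral ((h (F b - F a) (G b) + h (F a) (G b - G a))
          - integral {a..b} (\<lambda>t. h (f t) (G t) + h (F t) (g t)))) {a..b}"
        unfolding r_def using i2 i3
        by (intro has_integral_diff has_integral_add integrable_integral)
      have "norm (integral {a..b} r) \<le> integral {a..b} (\<lambda>t. e * (norm (f t) + norm (g t)))"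
      proof (rule integral_norm_bound_integral)
        show "r integrable_on {a..b}"
          using i4 by blast
        show "(\<lambda>t. e * (norm (f t) + norm (g t))) integrable_on {a..b}"
          using ab absolutely_integrable_norm[OF intf, unfolded o_def] absolutely_integrable_norm[OF intg, unfolded o_def]
          by (intro integrable_on_mult_right integrable_add abs_integrable_imp_integrable_sub) auto
      next
        fix t
        assume t: "t \<in> {a..b}"
        have "norm (G b - G x) < e'" "norm (G t - G x) < e'" "norm (F a - F x) < e'" "norm (F t - F x) < e'"
          using ab t by (auto intro!: d1(2) d2(2))
        moreover have "norm (G b - G t) \<le> norm (G b - G x) + norm (G t - G x)"
          "norm (F a - F t) \<le> norm (F a - F x) + norm (F t - F x)"
          using norm_triangle_ineq4[of "G b - G x" "G t - G x"] norm_triangle_ineq4[of "F a - F x" "F t - F x"]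
          by simp_all
        ultimately have Gt: "norm (G b - G t) \<le> 2 * e'" and Ft: "norm (F a - F t) \<le> 2 * e'"
          by linarith+
        have "r t = h (f t) (G b - G t) + h (F a - F t) (g t)"
          by (simp add: r_def h.diff_left h.diff_right)
        then have "norm (r t) \<le> norm (h (f t) (G b - G t)) + norm (h (F a - F t) (g t))"
          using norm_triangle_ineq by simp
        also have "\<dots> \<le> norm (f t) * norm (G b - G t) * B + norm (F a - F t) * norm (g t) * B"
          by (intro add_mono B(2))
        also have "\<dots> \<le> norm (f t) * (2 * e') * B + (2 * e') * norm (g t) * B"
          by (rule add_mono[OF mult_right_mono[OF mult_left_mono[OF Gt norm_ge_zero] less_imp_le[OF B(1)]]
              mult_right_mono[OF mult_right_mono[OF Ft norm_ge_zero] less_imp_le[OF B(1)]]])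
        also have "\<dots> = e * (norm (f t) + norm (g t))"
          unfolding eB by (simp add: algebra_simps)
        finally show "norm (r t) \<le> e * (norm (f t) + norm (g t))" .
      qed
      moreover have "h (F b) (G b) - h (F a) (G a) = h (F b - F a) (G b) + h (F a) (G b - G a)"
        unfolding h.diff_left h.diff_right by simp
      ultimately show ?thesis
        unfolding integral_unique[OF i4] by (simp only: integral_mult_right)
    qed
    with d1(1) d2(1) show "\<exists>d>0. \<forall>a b. 0 \<le> a \<and> a \<le> x \<and> x \<le> b \<and> b \<le> 1 \<and> b - a < d
      \<longrightarrow> norm (h (F b) (G b) - h (F a) (G a) - integral {a..b} (\<lambda>x. h (f x) (G x) + h (F x) (g x)))
        \<le> e * integral {a..b} (\<lambda>x. norm (f x) + norm (g x))"
      by (intro exI[of _ "min d1 d2"] conjI allI impI) simp_all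
  qed
qed

text \<open>By the mean value theorem the increment is \<open>\<Phi>' c * (F b - F a)\<close>, the
  exact integral of \<open>\<Phi>' c * f t\<close>. Both \<open>c\<close> and \<open>F t\<close> lie
  close to \<open>F x\<close>, so continuity of \<open>\<Phi>'\<close> bounds the change from
  \<open>\<Phi>' c\<close> to \<open>\<Phi>' (F t)\<close> by \<open>e\<close>.\<close>

lemma AC_chain:
  fixes F f \<Phi> \<Phi>' :: "real \<Rightarrow> real"
  assumes F: "AC F f" and \<Phi>: "\<And>y. (\<Phi> has_field_derivative \<Phi>' y) (at y)" and cont: "continuous_on UNIV \<Phi>'"
  shows "AC (\<lambda>x. \<Phi> (F x)) (\<lambda>x. \<Phi>' (F x) * f x)"
proof -
  note intf = AC_integrable[OF F]
  have contF: "continuous_on {0..1} (\<lambda>x. \<Phi>' (F x))"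
    using continuous_on_compose2[OF cont AC_continuous_on[OF F]] by auto
  have int1: "(\<lambda>x. \<Phi>' (F x) * f x) absolutely_integrable_on {0..1}"
    using abs_integrable_continuous_bilinear[OF bounded_bilinear_mult contF intf] .
  show ?thesis
  proof (rule AC_I_local[where m = "\<lambda>x. norm (f x)", OF int1])
    show "(\<lambda>x. norm (f x)) absolutely_integrable_on {0..1}"
      using intf by (intro absolutely_integrable_norm[unfolded o_def])
  next
    fix x e :: real
    assume x: "0 \<le> x" "x \<le> 1" and e: "e > 0"
    obtain d' where d': "d' > 0" "\<And>y. \<bar>y - F x\<bar> < d' \<Longrightarrow> \<bar>\<Phi>' y - \<Phi>' (F x)\<bar> < e / 2"
      using cont e unfolding continuous_on_iff dist_norm by (metis UNIV_I half_gt_zero real_norm_def)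
    obtain d where d: "d > 0" "\<And>y. y \<in> {0..1} \<Longrightarrow> \<bar>y - x\<bar> < d \<Longrightarrow> \<bar>F y - F x\<bar> < d'"
      using AC_continuous_on[OF F] x d'(1) unfolding continuous_on_iff dist_norm by (metis atLeastAtMost_iff real_norm_def)
    have "norm (\<Phi> (F b) - \<Phi> (F a) - integral {a..b} (\<lambda>x. \<Phi>' (F x) * f x)) \<le> e * integral {a..b} (\<lambda>x. norm (f x))"
      if ab: "0 \<le> a" "a \<le> x" "x \<le> b" "b \<le> 1" "b - a < d" for a b
    proof -
      have i1: "(f has_integral (F b - F a)) {a..b}"
        using AC_diff[OF F, of a b] ab abs_integrable_imp_integrable_sub[OF intf, of a b]
        by (simp_all add: has_integral_iff)
      have near: "\<bar>F t - F x\<bar> < d'" if "t \<in> {a..b}" for t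
        using d(2)[of t] that ab by auto
      \<comment> \<open>\<open>MVT2\<close> asks for strictly ordered endpoints, so
        \<open>F a = F b\<close> is split off; \<open>min\<close> and \<open>max\<close> treat both
        orders at once. Lying between \<open>F a\<close> and \<open>F b\<close>, the point
        \<open>c\<close> is as close to \<open>F x\<close> as they are.\<close>
      obtain c where c: "\<Phi> (F b) - \<Phi> (F a) = (F b - F a) * \<Phi>' c" "\<bar>c - F x\<bar> < d'"
      proof (cases "F a = F b")
        case True
        then show ?thesis
          using that[of "F x"] d'(1) by simp
      next
        case False
        then have "\<exists>c. min (F a) (F b) < c \<and> c < max (F a) (F b) \<and>
            \<Phi> (max (F a) (F b)) - \<Phi> (min (F a) (F b)) = (max (F a) (F b) - min (F a) (F b)) * \<Phi>' c"
          using \<Phi> by (intro MVT2) auto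
        then obtain c where "min (F a) (F b) < c" "c < max (F a) (F b)"
            "\<Phi> (max (F a) (F b)) - \<Phi> (min (F a) (F b)) = (max (F a) (F b) - min (F a) (F b)) * \<Phi>' c"
          by blast
        then show ?thesis
          using that[of c] near[of a] near[of b] ab by (auto simp: max_def min_def algebra_simps split: if_splits)
      qed
      have i2: "((\<lambda>t. \<Phi>' c * f t) has_integral \<Phi>' c * (F b - F a)) {a..b}"
        using i1 by (rule has_integral_mult_right)
      have i4: "((\<lambda>t. \<Phi>' c * f t - \<Phi>' (F t) * f t) has_integral
          (\<Phi>' c * (F b - F a) - integral {a..b} (\<lambda>t. \<Phi>' (F t) * f t))) {a..b}"
        using i2 ab by (intro has_integral_diff integrable_integral abs_integrable_imp_integrable_sub int1)
      have "norm (integral {a..b} (\<lambda>t. \<Phi>' c * f t - \<Phi>' (F t) * f t)) \<le> integral {a..b} (\<lambda>t. e * norm (f t))"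
      proof (rule integral_norm_bound_integral)
        show "(\<lambda>t. \<Phi>' c * f t - \<Phi>' (F t) * f t) integrable_on {a..b}"
          using i4 by blast
        show "(\<lambda>t. e * norm (f t)) integrable_on {a..b}"
          using ab absolutely_integrable_norm[OF intf, unfolded o_def]
          by (intro integrable_on_mult_right abs_integrable_imp_integrable_sub) auto
      next
        fix t
        assume t: "t \<in> {a..b}"
        have "\<bar>\<Phi>' c - \<Phi>' (F t)\<bar> \<le> e"
          using d'(2)[OF c(2)] d'(2)[OF near[OF t]] by linarith
        then show "norm (\<Phi>' c * f t - \<Phi>' (F t) * f t) \<le> e * norm (f t)"
          by (simp add: left_diff_distrib[symmetric] abs_mult mult_right_mono)
      qed
      with c(1) show ?thesis
        using integral_unique[OF i4] by (simp add: mult.commute)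
    qed
    with d(1) show "\<exists>d>0. \<forall>a b. 0 \<le> a \<and> a \<le> x \<and> x \<le> b \<and> b \<le> 1 \<and> b - a < d
      \<longrightarrow> norm (\<Phi> (F b) - \<Phi> (F a) - integral {a..b} (\<lambda>x. \<Phi>' (F x) * f x)) \<le> e * integral {a..b} (\<lambda>x. norm (f x))"
      by blast
  qed
qed

lemma AC_of_deriv:
  fixes F f :: "real \<Rightarrow> real"
  assumes "\<And>x. (F has_field_derivative f x) (at x)" "continuous_on UNIV f"
  shows "AC F f"
proof -
  have "(f has_integral (F x - F 0)) {0..x}" if "0 \<le> x" for x
    using that assms(1) by (intro fundamental_theorem_of_calculus)
      (auto simp: has_real_derivative_iff_has_vector_derivative[symmetric] intro: DERIV_subset)
  then show ?thesis
    using continuous_on_subset[OF assms(2)]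
    by (auto simp: AC_def has_integral_iff intro!: absolutely_integrable_continuous_real)
qed

section \<open>Weak derivatives and the space H1\<close>

lemma abs_integrable_on_iff_integrable:
  "f absolutely_integrable_on {0..1::real} \<longleftrightarrow> integrable unit_leb f"
  by (simp add: integrable_restrict_space set_integrable_def)

lemma finite_measure_unit_leb: "finite_measure unit_leb"
  by (rule finite_measure_lebesgue_on) simp

section \<open>Square integrable functions on the unit interval\<close>

lemma L2_measurable: "f \<in> L2 \<Longrightarrow> f \<in> borel_measurable unit_leb"
  by (simp add: L2_def)

lemma L2_abs_integrable:
  assumes "f \<in> L2"
  shows "f absolutely_integrable_on {0..1}"
proof -
  have "integrable unit_leb (\<lambda>x. 1 + (norm (f x))\<^sup>2)"
    using assms finite_measure.integrable_const[OF finite_measure_unit_leb]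
    by (intro Bochner_Integration.integrable_add) (auto simp: L2_def)
  \<comment> \<open>For the norm \<open>t\<close>, the square of \<open>t - 1/2\<close> is
    nonnegative, so \<open>t\<close> is at most its own square plus 1/4.\<close>
  moreover have "norm (f x) \<le> norm (1 + (norm (f x))\<^sup>2)" for x
    using zero_le_power2[of "norm (f x) - 1/2"] by (simp add: power2_diff power_divide)
  ultimately show ?thesis
    unfolding abs_integrable_on_iff_integrable
    using L2_measurable[OF assms] Bochner_Integration.integrable_bound by blast
qed

lemma L2_I:
  fixes f :: "real \<Rightarrow> complex^'n"
  assumes "f \<in> borel_measurable unit_leb" "integrable unit_leb h"
    "\<And>x. x \<in> {0..1} \<Longrightarrow> (norm (f x))\<^sup>2 \<le> h x"
  shows "f \<in> L2"
proof -
  have "(\<lambda>x. (norm (f x))\<^sup>2) \<in> borel_measurable unit_leb"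
    using assms(1) by measurable
  moreover have "AE x in unit_leb. norm ((norm (f x))\<^sup>2) \<le> norm (h x)"
  proof (rule AE_I2)
    fix x
    assume "x \<in> space unit_leb"
    then have "(norm (f x))\<^sup>2 \<le> h x"
      using assms(3) by simp
    then show "norm ((norm (f x))\<^sup>2) \<le> norm (h x)"
      by (simp add: order_trans[OF _ abs_ge_self])
  qed
  ultimately have "integrable unit_leb (\<lambda>x. (norm (f x))\<^sup>2)"
    by (rule Bochner_Integration.integrable_bound[OF assms(2)])
  with assms(1) show ?thesis
    by (simp add: L2_def)
qed

lemma L2_I_bound:
  assumes "f \<in> borel_measurable unit_leb" "g \<in> L2" "\<And>x. x \<in> {0..1} \<Longrightarrow> norm (f x) \<le> C * norm (g x)"
  shows "f \<in> L2"
proof -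
  have "integrable unit_leb (\<lambda>x. C\<^sup>2 * (norm (g x))\<^sup>2)"
    using assms(2) by (simp add: L2_def)
  moreover have "(norm (f x))\<^sup>2 \<le> C\<^sup>2 * (norm (g x))\<^sup>2" if "x \<in> {0..1}" for x
    unfolding power_mult_distrib[symmetric] using assms(3)[OF that] by (intro power_mono) auto
  ultimately show ?thesis
    using L2_I[OF assms(1)] by blast
qed

lemma L2_diff:
  assumes "f \<in> L2" "g \<in> L2"
  shows "(\<lambda>x. f x - g x) \<in> L2"
proof -
  have m: "(\<lambda>x. f x - g x) \<in> borel_measurable unit_leb"
    using assms by (intro borel_measurable_diff L2_measurable)
  have "integrable unit_leb (\<lambda>x. 2 * (norm (f x))\<^sup>2 + 2 * (norm (g x))\<^sup>2)"
    using assms by (simp add: L2_def)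
  moreover have "(norm (f x - g x))\<^sup>2 \<le> 2 * (norm (f x))\<^sup>2 + 2 * (norm (g x))\<^sup>2" for x
  proof -
    have "(norm (f x - g x))\<^sup>2 \<le> (norm (f x) + norm (g x))\<^sup>2"
      by (intro power_mono norm_triangle_ineq4) simp
    also have "\<dots> \<le> 2 * (norm (f x))\<^sup>2 + 2 * (norm (g x))\<^sup>2"
      using zero_le_power2[of "norm (f x) - norm (g x)"] by (simp add: power2_sum power2_diff)
    finally show ?thesis .
  qed
  ultimately show ?thesis
    using L2_I[OF m] by blast
qed

lemma continuous_measurable_unit_leb:
  "continuous_on {0..1::real} f \<Longrightarrow> f \<in> borel_measurable unit_leb"
  by (rule continuous_imp_measurable_on_sets_lebesgue) simp_all

lemma L2_continuous:
  fixes w :: "real \<Rightarrow> complex^'n"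
  assumes "continuous_on {0..1} w"
  shows "w \<in> L2"
proof (rule L2_I)
  show "w \<in> borel_measurable unit_leb"
    using assms by (rule continuous_measurable_unit_leb)
  show "integrable unit_leb (\<lambda>x. (norm (w x))\<^sup>2)"
    by (intro continuous_imp_integrable_real continuous_intros assms)
qed simp

text \<open>Integration by parts: the product rule for \<phi> and \<open>w\<close> leaves no
  boundary terms, because a test function vanishes at 0 and at 1.\<close>

lemma AC_imp_weak_deriv:
  assumes "AC w v"
  shows "is_weak_deriv w v"
  unfolding is_weak_deriv_def
proof
  fix \<phi>
  assume "\<phi> \<in> C1c"
  then obtain a b where \<phi>: "\<And>x. \<phi> differentiable (at x)" "continuous_on UNIV (deriv \<phi>)"
    "0 < a" "b < 1" "\<And>x. x \<notin> {a..b} \<Longrightarrow> \<phi> x = 0"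
    by (auto simp: C1c_def)
  have "(\<phi> has_field_derivative deriv \<phi> x) (at x)" for x
    using \<phi>(1) by (simp add: DERIV_deriv_iff_real_differentiable)
  then have AC\<phi>: "AC \<phi> (deriv \<phi>)"
    using \<phi>(2) by (rule AC_of_deriv)
  have int1: "(\<lambda>x. deriv \<phi> x *\<^sub>R w x) absolutely_integrable_on {0..1}"
    using continuous_on_subset[OF \<phi>(2)] AC_continuous_on[OF assms]
    by (intro absolutely_integrable_continuous_real continuous_intros) auto
  have int2: "(\<lambda>x. \<phi> x *\<^sub>R v x) absolutely_integrable_on {0..1}"
    by (rule abs_integrable_continuous_bilinear[OF bounded_bilinear_scaleR AC_continuous_on[OF AC\<phi>] AC_integrable[OF assms]])
  have "integral {0..1} (\<lambda>x. deriv \<phi> x *\<^sub>R w x + \<phi> x *\<^sub>R v x) = \<phi> 1 *\<^sub>R w 1 - \<phi> 0 *\<^sub>R w 0"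
    by (intro AC_diff[symmetric] AC_bilinear[OF bounded_bilinear_scaleR] AC\<phi> assms) auto
  also have "\<dots> = 0"
    using \<phi>(3,4) \<phi>(5)[of 0] \<phi>(5)[of 1] by simp
  finally have "integral {0..1} (\<lambda>x. deriv \<phi> x *\<^sub>R w x) + integral {0..1} (\<lambda>x. \<phi> x *\<^sub>R v x) = 0"
    using int1 int2 by (simp add: Henstock_Kurzweil_Integration.integral_add set_lebesgue_integral_eq_integral(1))
  then show "(LINT x|unit_leb. deriv \<phi> x *\<^sub>R w x) = - (LINT x|unit_leb. \<phi> x *\<^sub>R v x)"
    using int1 int2
    by (simp add: lebesgue_integral_eq_integral abs_integrable_on_iff_integrable eq_neg_iff_add_eq_0)
qed

text \<open>Source of test functions with a prescribed derivative. The zero mean makes the primitive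
  vanish again to the right of the support.\<close>

lemma integral_in_C1c:
  fixes \<psi> :: "real \<Rightarrow> real"
  assumes cont: "continuous_on UNIV \<psi>" and ab: "0 < a" "b < 1" and supp: "\<And>x. x \<notin> {a..b} \<Longrightarrow> \<psi> x = 0"
    and mean: "integral {0..1} \<psi> = 0"
  shows "(\<lambda>x. integral {0..x} \<psi>) \<in> C1c" "deriv (\<lambda>x. integral {0..x} \<psi>) = \<psi>"
proof -
  let ?\<phi> = "\<lambda>x. integral {0..x} \<psi>"
  have int: "\<psi> integrable_on {c..d}" for c d
    using continuous_on_subset[OF cont] by (intro integrable_continuous_real) auto
  have zero: "?\<phi> x = 0" if "x \<notin> {a..b}" for x
  proof (cases "x < a")
    case True
    then have "?\<phi> x = integral {0..x} (\<lambda>_. 0)"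
      by (intro Henstock_Kurzweil_Integration.integral_cong supp) auto
    then show ?thesis
      by simp
  next
    case False
    with that have "b < x" "a \<le> x"
      by auto
    \<comment> \<open>Passing through \<open>max 1 x\<close> treats points of the unit interval and
      points beyond it together; both stretches crossed lie to the right of \<open>b\<close>, where
      \<psi> vanishes.\<close>
    have "?\<phi> x = ?\<phi> (max 1 x)"
    proof -
      have "?\<phi> x + integral {x..max 1 x} \<psi> = ?\<phi> (max 1 x)"
        using ab \<open>a \<le> x\<close> by (intro Henstock_Kurzweil_Integration.integral_combine int) auto
      moreover have "integral {x..max 1 x} \<psi> = integral {x..max 1 x} (\<lambda>_. 0)"
        using \<open>b < x\<close> by (intro Henstock_Kurzweil_Integration.integral_cong supp) auto
      ultimately show ?thesis
        by simp
    qed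
    also have "\<dots> = ?\<phi> 1 + integral {1..max 1 x} \<psi>"
      by (intro Henstock_Kurzweil_Integration.integral_combine[symmetric] int) auto
    also have "integral {1..max 1 x} \<psi> = integral {1..max 1 x} (\<lambda>_. 0)"
      using ab by (intro Henstock_Kurzweil_Integration.integral_cong supp) auto
    finally show ?thesis
      by (simp add: mean)
  qed
  have deriv: "(?\<phi> has_field_derivative \<psi> x) (at x)" for x
  proof (cases "x \<in> {a..b}")
    case True
    have "(?\<phi> has_real_derivative \<psi> x) (at x within {0..1})"
      using True ab by (intro integral_has_real_derivative continuous_on_subset[OF cont]) auto
    then show ?thesis
      using True ab by (simp add: at_within_Icc_at)
  next
    case False
    have "((\<lambda>_. 0) has_field_derivative 0) (at x)"
      by simp
    then have "(?\<phi> has_field_derivative 0) (at x)"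
      by (rule has_field_derivative_transform_within_open[where S = "- {a..b}"]) (use False zero in auto)
    with supp[OF False] show ?thesis
      by simp
  qed
  then show d: "deriv ?\<phi> = \<psi>"
    by (intro ext DERIV_imp_deriv)
  show "?\<phi> \<in> C1c"
    unfolding C1c_def mem_Collect_eq d
  proof (intro conjI exI allI impI)
    show "?\<phi> differentiable (at x)" for x
      using deriv real_differentiable_def by blast
  qed (use cont ab zero in simp_all)
qed

text \<open>Product of two ramps of slope \<open>k\<close>, a continuous stand-in for the indicator
  of the open interval. Continuity is the right degree of smoothness: cutoffs enter as derivatives
  of test functions, and \<open>C1c\<close> asks for continuous derivatives.\<close>

definition cutoff :: "real \<Rightarrow> real \<Rightarrow> nat \<Rightarrow> real \<Rightarrow> real"
  where "cutoff p q k x = min 1 (max 0 (real k * (x - p))) * min 1 (max 0 (real k * (q - x)))"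

lemma cutoff_continuous: "continuous_on S (cutoff p q k)"
  unfolding cutoff_def by (intro continuous_intros)

lemma cutoff_outside: "x \<notin> {p..q} \<Longrightarrow> cutoff p q k x = 0"
  by (auto simp: cutoff_def max_absorb1 mult_le_0_iff not_le)

lemma cutoff_bound: "\<bar>cutoff p q k x\<bar> \<le> 1"
  unfolding cutoff_def by (simp add: abs_mult mult_le_one)

lemma min_max_tendsto: "y > 0 \<Longrightarrow> (\<lambda>k. min 1 (max 0 (real k * y))) \<longlonglongrightarrow> 1"
proof (rule tendsto_eventually)
  assume "y > 0"
  then obtain N where N: "1 < real N * y"
    using reals_Archimedean3 by blast
  have "min 1 (max 0 (real k * y)) = 1" if "k \<ge> N" for k
  proof -
    have "real N * y \<le> real k * y"
      using that \<open>y > 0\<close> by simp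
    with N show ?thesis
      by simp
  qed
  then show "\<forall>\<^sub>F k in sequentially. min 1 (max 0 (real k * y)) = 1"
    by (auto simp: eventually_sequentially)
qed

lemma cutoff_tendsto: "(\<lambda>k. cutoff p q k x) \<longlonglongrightarrow> (if x \<in> {p<..<q} then 1 else 0)"
proof (cases "x \<in> {p<..<q}")
  case True
  then show ?thesis
    using tendsto_mult[OF min_max_tendsto[of "x - p"] min_max_tendsto[of "q - x"]]
    by (simp add: cutoff_def)
next
  case False
  then have "cutoff p q k x = 0" for k
    by (auto simp: cutoff_def max_absorb1 mult_le_0_iff not_less)
  with False show ?thesis
    by (simp only: if_False tendsto_const)
qed

lemma integral_cutoff_tendsto:
  fixes f :: "real \<Rightarrow> 'a::euclidean_space"
  assumes f: "f absolutely_integrable_on {0..1}" and pq: "0 \<le> p" "q \<le> 1"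
  shows "(\<lambda>k. integral {0..1} (\<lambda>x. cutoff p q k x *\<^sub>R f x)) \<longlonglongrightarrow> integral {p..q} f"
proof -
  have "(\<lambda>k. integral {0..1} (\<lambda>x. cutoff p q k x *\<^sub>R f x)) \<longlonglongrightarrow>
      integral {0..1} (\<lambda>x. if x \<in> {p<..<q} then f x else 0)"
  proof (rule dominated_convergence(2)[where h = "\<lambda>x. norm (f x)"])
    show "(\<lambda>x. cutoff p q k x *\<^sub>R f x) integrable_on {0..1}" for k
      using abs_integrable_continuous_bilinear[OF bounded_bilinear_scaleR cutoff_continuous f]
      by (rule set_lebesgue_integral_eq_integral(1))
    show "(\<lambda>x. norm (f x)) integrable_on {0..1}"
      using absolutely_integrable_norm[OF f] by (simp add: o_def set_lebesgue_integral_eq_integral(1))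
    show "norm (cutoff p q k x *\<^sub>R f x) \<le> norm (f x)" for k x
      using cutoff_bound[of p q k x] by (simp add: mult_left_le_one_le)
    show "(\<lambda>k. cutoff p q k x *\<^sub>R f x) \<longlonglongrightarrow> (if x \<in> {p<..<q} then f x else 0)" for x
      using tendsto_scaleR[OF cutoff_tendsto[of p q x] tendsto_const[of "f x"]] by (cases "x \<in> {p<..<q}") auto
  qed
  also have "integral {0..1} (\<lambda>x. if x \<in> {p<..<q} then f x else 0) = integral {p<..<q} f"
    using pq by (subst integral_restrict_Int) (auto intro: arg_cong[where f = "\<lambda>S. integral S f"])
  also have "\<dots> = integral {p..q} f"
    by (rule integral_open_interval_real[symmetric])
  finally show ?thesis .
qed

text \<open>
  The du Bois-Reymond lemma. Test functions with derivative
  \<open>(\<integral>\<chi>\<^sub>2) \<chi>\<^sub>1 - (\<integral>\<chi>\<^sub>1) \<chi>\<^sub>2\<close> for two cutoffs show that all mean values of \<open>f\<close> over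
  subintervals agree.
\<close>

lemma AE_const_of_orthogonal_derivs:
  fixes f :: "real \<Rightarrow> 'a::euclidean_space"
  assumes f: "f absolutely_integrable_on {0..1}"
    and orth: "\<And>\<phi>. \<phi> \<in> C1c \<Longrightarrow> integral {0..1} (\<lambda>x. deriv \<phi> x *\<^sub>R f x) = 0"
  shows "\<exists>c. AE x in unit_leb. f x = c"
proof -
  have one: "(\<lambda>_::real. 1 :: real) absolutely_integrable_on {0..1}"
    by (intro absolutely_integrable_continuous_real continuous_on_const)
  have mean: "(q' - p') *\<^sub>R integral {p..q} f = (q - p) *\<^sub>R integral {p'..q'} f"
    if pq: "0 < p" "p < q" "q < 1" "0 < p'" "p' < q'" "q' < 1" for p q p' q'
  proof -
    define I where "I = (\<lambda>p q k. integral {0..1} (cutoff p q k))"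
    define E where "E = (\<lambda>p q k. integral {0..1} (\<lambda>x. cutoff p q k x *\<^sub>R f x))"
    have int: "(\<lambda>x. cutoff p q k x *\<^sub>R f x) integrable_on {0..1}" for p q k
      using abs_integrable_continuous_bilinear[OF bounded_bilinear_scaleR cutoff_continuous f]
      by (rule set_lebesgue_integral_eq_integral(1))
    have I: "I p q \<longlonglongrightarrow> q - p" if "0 < p" "p < q" "q < 1" for p q
      using integral_cutoff_tendsto[OF one, of p q] that by (simp add: I_def)
    have E: "E p q \<longlonglongrightarrow> integral {p..q} f" if "0 < p" "p < q" "q < 1" for p q
      using integral_cutoff_tendsto[OF f, of p q] that by (simp add: E_def)
    have "I p' q' k *\<^sub>R E p q k = I p q k *\<^sub>R E p' q' k" for k
    proof -
      define \<psi> where "\<psi> = (\<lambda>x. I p' q' k * cutoff p q k x - I p q k * cutoff p' q' k x)"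
      have "continuous_on UNIV \<psi>"
        unfolding \<psi>_def by (intro continuous_intros cutoff_continuous)
      moreover have "\<psi> x = 0" if "x \<notin> {min p p'..max q q'}" for x
      proof -
        from that have "x \<notin> {p..q}" "x \<notin> {p'..q'}"
          by auto
        then show ?thesis
          by (simp add: \<psi>_def cutoff_outside del: atLeastAtMost_iff)
      qed
      moreover have "integral {0..1} \<psi> = 0"
        unfolding \<psi>_def
        by (subst Henstock_Kurzweil_Integration.integral_diff)
          (auto simp: I_def intro!: integrable_continuous_real cutoff_continuous continuous_intros)
      ultimately have \<psi>: "(\<lambda>x. integral {0..x} \<psi>) \<in> C1c" "deriv (\<lambda>x. integral {0..x} \<psi>) = \<psi>"
        using integral_in_C1c[of \<psi> "min p p'" "max q q'"] pq by auto
      have "0 = integral {0..1} (\<lambda>x. \<psi> x *\<^sub>R f x)"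
        using orth[OF \<psi>(1)] \<psi>(2) by simp
      also have "\<dots> = integral {0..1} (\<lambda>x. I p' q' k *\<^sub>R cutoff p q k x *\<^sub>R f x - I p q k *\<^sub>R cutoff p' q' k x *\<^sub>R f x)"
        by (simp add: \<psi>_def scaleR_diff_left)
      also have "\<dots> = I p' q' k *\<^sub>R E p q k - I p q k *\<^sub>R E p' q' k"
        unfolding E_def using int
        by (simp add: Henstock_Kurzweil_Integration.integral_diff integrable_cmul del: scaleR_scaleR)
      finally show ?thesis
        by simp
    qed
    moreover have "(\<lambda>k. I p' q' k *\<^sub>R E p q k) \<longlonglongrightarrow> (q' - p') *\<^sub>R integral {p..q} f"
      "(\<lambda>k. I p q k *\<^sub>R E p' q' k) \<longlonglongrightarrow> (q - p) *\<^sub>R integral {p'..q'} f"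
      using pq by (intro tendsto_scaleR I E; simp)+
    ultimately show ?thesis
      using LIMSEQ_unique by auto
  qed
  define c where "c = 2 *\<^sub>R integral {1/4..3/4} f"
  \<comment> \<open>Primitive of \<open>f - c\<close>. The mean value identity makes it constant on
    the open interval only, since the cutoffs are supported strictly inside; continuity extends this
    to the endpoints. The factor 2 in \<open>c\<close> is the inverse length of the reference
    interval.\<close>
  define H where "H = (\<lambda>x. integral {0..x} f - x *\<^sub>R c)"
  note int = abs_integrable_imp_integrable_sub[OF f]
  have H_diff: "H y - H x = integral {x..y} f - (y - x) *\<^sub>R c" if "0 \<le> x" "x \<le> y" "y \<le> 1" for x y
    using Henstock_Kurzweil_Integration.integral_combine[of 0 x y f] int[of 0 y] that
    by (simp add: H_def algebra_simps)
  have H_eq: "H y = H x" if "0 < x" "x < y" "y < 1" for x y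
  proof -
    have "(1/2) *\<^sub>R integral {x..y} f = (y - x) *\<^sub>R integral {1/4..3/4} f"
      using mean[of x y "1/4" "3/4"] that by simp
    then have "2 *\<^sub>R ((1/2) *\<^sub>R integral {x..y} f) = (y - x) *\<^sub>R c"
      by (simp add: c_def mult.commute)
    then have "integral {x..y} f = (y - x) *\<^sub>R c"
      by simp
    with H_diff[of x y] that show ?thesis
      by simp
  qed
  have cont: "continuous_on {0..1} H"
    unfolding H_def using int by (intro continuous_intros indefinite_integral_continuous_1) auto
  have H_const: "H x = H (1/2)" if "x \<in> {0..1}" for x
  proof (rule continuous_constant_on_closure[of "{0<..<1::real}"])
    show "H y = H (1/2)" if "y \<in> {0<..<1}" for y
    proof (cases y "1/2::real" rule: linorder_cases)
      case equal
      then show ?thesis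
        by (rule arg_cong)
    qed (use H_eq[of y "1/2"] H_eq[of "1/2" y] that in auto)
  qed (use cont that in auto)
  have const: "integral {x..y} f = (y - x) *\<^sub>R c" if "0 \<le> x" "x \<le> y" "y \<le> 1" for x y
  proof -
    have "H x = H (1/2)" "H y = H (1/2)"
      by (rule H_const, use that in simp)+
    with H_diff[OF that] show ?thesis
      by simp
  qed
  have "AE x in unit_leb. f x - c = 0"
  proof (rule AE_eq_zero_of_integral_Icc_eq_zero)
    show "(\<lambda>x. f x - c) absolutely_integrable_on {0..1}"
      by (intro set_integral_diff(1)[OF f] absolutely_integrable_continuous_real continuous_on_const)
    show "integral {x..y} (\<lambda>x. f x - c) = 0" if "0 \<le> x" "x \<le> y" "y \<le> 1" for x y
      using const[of x y] that int[of x y]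
      by (subst Henstock_Kurzweil_Integration.integral_diff) auto
  qed
  then show ?thesis
    by auto
qed

text \<open>Subtracting the primitive of \<open>v\<close> from \<open>u\<close> leaves a function
  orthogonal to all derivatives of test functions, hence constant almost everywhere; adding that
  constant to the primitive gives \<open>w\<close>.\<close>

lemma weak_deriv_imp_AC:
  assumes u: "u \<in> L2" and v: "v \<in> L2" and wd: "is_weak_deriv u v"
  obtains w where "AC w v" "AE x in unit_leb. w x = u x"
proof -
  define w where "w = (\<lambda>x. integral {0..x} v)"
  have w: "AC w v"
    using AC_I[OF L2_abs_integrable[OF v], of 0] by (simp add: w_def)
  have wL2: "w \<in> L2"
    using L2_continuous[OF AC_continuous_on[OF w]] .
  have f: "(\<lambda>x. u x - w x) absolutely_integrable_on {0..1}"
    using L2_abs_integrable[OF L2_diff[OF u wL2]] .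
  have "integral {0..1} (\<lambda>x. deriv \<phi> x *\<^sub>R (u x - w x)) = 0" if \<phi>: "\<phi> \<in> C1c" for \<phi>
  proof -
    have cont: "continuous_on {0..1} (deriv \<phi>)"
      using \<phi> continuous_on_subset by (auto simp: C1c_def)
    note int = abs_integrable_continuous_bilinear[OF bounded_bilinear_scaleR cont]
    have iu: "integrable unit_leb (\<lambda>x. deriv \<phi> x *\<^sub>R u x)" and iw: "integrable unit_leb (\<lambda>x. deriv \<phi> x *\<^sub>R w x)"
      using int[OF L2_abs_integrable[OF u]] int[OF L2_abs_integrable[OF wL2]]
      by (simp_all add: abs_integrable_on_iff_integrable)
    have "integral {0..1} (\<lambda>x. deriv \<phi> x *\<^sub>R (u x - w x)) = (LINT x|unit_leb. deriv \<phi> x *\<^sub>R (u x - w x))"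
      using int[OF f] by (simp add: abs_integrable_on_iff_integrable lebesgue_integral_eq_integral)
    also have "\<dots> = (LINT x|unit_leb. deriv \<phi> x *\<^sub>R u x) - (LINT x|unit_leb. deriv \<phi> x *\<^sub>R w x)"
      using iu iw by (simp add: scaleR_diff_right)
    also have "\<dots> = 0"
      using wd AC_imp_weak_deriv[OF w] \<phi> by (simp add: is_weak_deriv_def)
    finally show ?thesis .
  qed
  then obtain c where c: "AE x in unit_leb. u x - w x = c"
    using AE_const_of_orthogonal_derivs[OF f] by blast
  show ?thesis
  proof
    show "AC (\<lambda>x. c + w x) v"
      unfolding w_def by (rule AC_I[OF L2_abs_integrable[OF v]])
    show "AE x in unit_leb. c + w x = u x"
      using c by eventually_elim auto
  qed
qed

text \<open>The coincidence set is closed, and a closed set containing almost every point of an open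
  interval contains the interval. Its closure reaches 0 and 1, the points at which boundary values
  are read off.\<close>

lemma continuous_AE_eq:
  fixes w w' :: "real \<Rightarrow> 'a::euclidean_space"
  assumes "continuous_on {0..1} w" "continuous_on {0..1} w'" "AE x in unit_leb. w x = w' x" "x \<in> {0..1}"
  shows "w x = w' x"
proof -
  define C where "C = {x \<in> {0..1}. w x - w' x = 0}"
  have "closed C"
    unfolding C_def using assms
    by (intro continuous_closed_preimage_constant continuous_intros) auto
  have AE: "AE x\<in>{0<..<1} in lebesgue. x \<in> C"
    using assms(3) by (auto simp: AE_restrict_space_iff C_def elim!: eventually_mono)
  have "{0<..<1} \<subseteq> C"
    using mem_closed_if_AE_lebesgue_open[OF open_greaterThanLessThan \<open>closed C\<close> AE] by (rule subsetI)
  then have "closure {0<..<1} \<subseteq> C"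
    using \<open>closed C\<close> by (rule closure_minimal)
  with assms(4) show ?thesis
    by (auto simp: C_def)
qed

section \<open>Independence of \<open>cont_rep\<close> and \<open>weak_deriv\<close> from the choice
  made\<close>

lemma cont_rep_eq:
  fixes w :: "real \<Rightarrow> complex^'n"
  assumes "continuous_on {0..1} w" "AE x in unit_leb. w x = u x" "x \<in> {0..1}"
  shows "cont_rep u x = w x"
proof -
  have "continuous_on {0..1} (cont_rep u) \<and> (AE x in unit_leb. cont_rep u x = u x)"
    unfolding cont_rep_def by (rule someI[of _ w]) (use assms in blast)
  moreover from this have "AE x in unit_leb. cont_rep u x = w x"
    using assms(2) by (auto elim: eventually_elim2)
  ultimately show ?thesis
    using continuous_AE_eq[of "cont_rep u" w] assms by blast
qed

text \<open>Later arguments about a given element of \<open>H1\<close> use this form: chosen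
  representative and chosen derivative fit together as one \<open>AC\<close> pair, so boundary
  values obey the fundamental theorem of calculus.\<close>

lemma H1_AC:
  assumes "u \<in> H1"
  shows "weak_deriv u \<in> L2" "is_weak_deriv u (weak_deriv u)" "AC (cont_rep u) (weak_deriv u)"
    "AE x in unit_leb. cont_rep u x = u x"
proof -
  obtain v where "v \<in> L2 \<and> is_weak_deriv u v"
    using assms by (auto simp: H1_def)
  then have "weak_deriv u \<in> L2 \<and> is_weak_deriv u (weak_deriv u)"
    unfolding weak_deriv_def by (rule someI[where P = "\<lambda>v. v \<in> L2 \<and> is_weak_deriv u v"])
  then show wd: "weak_deriv u \<in> L2" "is_weak_deriv u (weak_deriv u)"
    by auto
  have "u \<in> L2"
    using assms by (simp add: H1_def)
  then obtain w where w: "AC w (weak_deriv u)" "AE x in unit_leb. w x = u x"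
    using weak_deriv_imp_AC wd by blast
  have eq: "cont_rep u x = w x" if "x \<in> {0..1}" for x
    using cont_rep_eq[OF AC_continuous_on[OF w(1)] w(2) that] .
  show "AC (cont_rep u) (weak_deriv u)"
    using w(1) eq by (rule AC_cong)
  show "AE x in unit_leb. cont_rep u x = u x"
    using w(2) AE_space by eventually_elim (auto simp: eq)
qed

text \<open>The converse passage, for the resolvent constructed below. The weak derivative and
  \<open>v\<close> have the same integral over every subinterval, namely the increment of
  \<open>w\<close>, so they agree almost everywhere.\<close>

lemma H1_I_AC:
  fixes u v w :: "real \<Rightarrow> complex^'n"
  assumes u: "u \<in> L2" and v: "v \<in> L2" and w: "AC w v" "AE x in unit_leb. w x = u x"
  shows "u \<in> H1" "AE x in unit_leb. weak_deriv u x = v x" "\<And>x. x \<in> {0..1} \<Longrightarrow> cont_rep u x = w x"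
proof -
  have wL2: "w \<in> L2"
    using L2_continuous[OF AC_continuous_on[OF w(1)]] .
  have "(LINT x|unit_leb. deriv \<phi> x *\<^sub>R u x) = (LINT x|unit_leb. deriv \<phi> x *\<^sub>R w x)" if "\<phi> \<in> C1c" for \<phi>
  proof (rule integral_cong_AE)
    have "deriv \<phi> \<in> borel_measurable unit_leb"
      using that continuous_on_subset by (intro continuous_measurable_unit_leb) (auto simp: C1c_def)
    then show "(\<lambda>x. deriv \<phi> x *\<^sub>R u x) \<in> borel_measurable unit_leb" "(\<lambda>x. deriv \<phi> x *\<^sub>R w x) \<in> borel_measurable unit_leb"
      using L2_measurable[OF u] L2_measurable[OF wL2] by (auto intro: borel_measurable_scaleR)
    show "AE x in unit_leb. deriv \<phi> x *\<^sub>R u x = deriv \<phi> x *\<^sub>R w x"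
      using w(2) by eventually_elim simp
  qed
  then have "is_weak_deriv u v"
    using AC_imp_weak_deriv[OF w(1)] by (simp add: is_weak_deriv_def)
  with u v show H1: "u \<in> H1"
    by (auto simp: H1_def)
  show cr: "cont_rep u x = w x" if "x \<in> {0..1}" for x
    using cont_rep_eq[OF AC_continuous_on[OF w(1)] w(2) that] .
  have "AE x in unit_leb. weak_deriv u x - v x = 0"
  proof (rule AE_eq_zero_of_integral_Icc_eq_zero)
    show "(\<lambda>x. weak_deriv u x - v x) absolutely_integrable_on {0..1}"
      using L2_abs_integrable[OF L2_diff[OF H1_AC(1)[OF H1] v]] .
    show "integral {x..y} (\<lambda>x. weak_deriv u x - v x) = 0" if "0 \<le> x" "x \<le> y" "y \<le> 1" for x y
      using AC_diff[OF w(1), of x y] AC_diff[OF H1_AC(3)[OF H1], of x y] cr[of x] cr[of y] that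
        abs_integrable_imp_integrable_sub[OF L2_abs_integrable[OF H1_AC(1)[OF H1]], of x y]
        abs_integrable_imp_integrable_sub[OF L2_abs_integrable[OF v], of x y]
      by (subst Henstock_Kurzweil_Integration.integral_diff) auto
  qed
  then show "AE x in unit_leb. weak_deriv u x = v x"
    by eventually_elim simp
qed

section \<open>Positive semidefinite matrices and their square roots\<close>

lemma ctranspose_ctranspose [simp]: "ctranspose (ctranspose M) = M"
  by (simp add: ctranspose_def vec_eq_iff)

lemma ctranspose_mat_1 [simp]: "ctranspose (mat 1) = mat 1"
  by (simp add: ctranspose_def mat_def vec_eq_iff)

lemma ctranspose_add: "ctranspose (M + N) = ctranspose M + ctranspose N"
  by (simp add: ctranspose_def vec_eq_iff)

lemma ctranspose_diff: "ctranspose (M - N) = ctranspose M - ctranspose N"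
  by (simp add: ctranspose_def vec_eq_iff)

lemma ctranspose_scaleR: "ctranspose (a *\<^sub>R M) = a *\<^sub>R ctranspose M"
  by (simp add: ctranspose_def vec_eq_iff)

lemma ctranspose_matrix_mul: "ctranspose (M ** N) = ctranspose N ** ctranspose M"
  by (simp add: ctranspose_def vec_eq_iff matrix_matrix_mult_def mult.commute)

lemma cinner_matrix_left: "cinner (M *v x) y = cinner x (ctranspose M *v y)"
proof -
  have "cinner (M *v x) y = (\<Sum>i\<in>UNIV. \<Sum>j\<in>UNIV. cnj (y $ i) * (M $ i $ j * x $ j))"
    by (simp add: cinner_def matrix_vector_mult_def sum_distrib_left)
  also have "\<dots> = (\<Sum>j\<in>UNIV. \<Sum>i\<in>UNIV. cnj (y $ i) * (M $ i $ j * x $ j))"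
    by (rule sum.swap)
  also have "\<dots> = cinner x (ctranspose M *v y)"
    by (simp add: cinner_def matrix_vector_mult_def ctranspose_def sum_distrib_left mult_ac)
  finally show ?thesis .
qed

text \<open>Transfers positivity to the real inner product of the underlying Euclidean space, where
  Cauchy-Schwarz and the expansion of squares are at hand.\<close>

lemma Re_cinner: "Re (cinner x y) = x \<bullet> y"
  by (simp add: cinner_def inner_vec_def inner_complex_def algebra_simps)

lemma inner_matrix_left: "(M *v x) \<bullet> y = x \<bullet> (ctranspose M *v y)" for M :: "complex^'n^'m"
  by (simp flip: Re_cinner add: cinner_matrix_left)

lemma bounded_bilinear_cinner: "bounded_bilinear (cinner :: complex^'n \<Rightarrow> complex^'n \<Rightarrow> complex)"
proof -
  have "bilinear (cinner :: complex^'n \<Rightarrow> complex^'n \<Rightarrow> complex)"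
    unfolding bilinear_def linear_iff cinner_def
    by (simp add: algebra_simps sum.distrib scaleR_sum_right)
  then show ?thesis
    by (simp add: bilinear_conv_bounded_bilinear)
qed

lemma matrix_vector_axis_nth: "(M *v axis j 1) $ i = M $ i $ j" for M :: "complex^'n^'m"
  by (simp add: matrix_vector_mult_def axis_def if_distrib cong: if_cong)

lemma scaleR_matrix_vector: "(a *\<^sub>R M) *v x = a *\<^sub>R (M *v x)" for M :: "complex^'n^'m"
  by (simp add: matrix_vector_mult_def vec_eq_iff scaleR_sum_right)

lemma matrix_vector_scaleR: "M *v (a *\<^sub>R x) = a *\<^sub>R (M *v x)" for M :: "complex^'n^'m"
  by (rule linear_scale[OF matrix_vector_mul_linear])

lemma psd_iff: "psd M \<longleftrightarrow> ctranspose M = M \<and> (\<forall>x. 0 \<le> (M *v x) \<bullet> x)"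
  by (simp add: psd_def Re_cinner)

lemma psd_mat_1: "psd (mat 1)"
  by (simp add: psd_iff)

lemma psd_add: "psd M \<Longrightarrow> psd N \<Longrightarrow> psd (M + N)"
  by (auto simp: psd_iff ctranspose_add matrix_vector_mult_add_rdistrib inner_add_left)

lemma psd_conj:
  assumes "psd M"
  shows "psd (ctranspose N ** M ** N)"
  unfolding psd_iff
proof (intro conjI allI)
  show "ctranspose (ctranspose N ** M ** N) = ctranspose N ** M ** N"
    using assms by (simp add: psd_iff ctranspose_matrix_mul matrix_mul_assoc)
  fix x
  have "((ctranspose N ** M ** N) *v x) \<bullet> x = (M *v (N *v x)) \<bullet> (N *v x)"
    by (simp add: inner_matrix_left flip: matrix_vector_mul_assoc)
  then show "0 \<le> ((ctranspose N ** M ** N) *v x) \<bullet> x"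
    using assms by (simp add: psd_iff)
qed

text \<open>A Cauchy-Schwarz estimate for the form of \<open>P\<close>: with
  \<open>y = P *v x\<close> and \<open>c\<close> a bound for the operator norm, its value at
  \<open>x - (1 / c) *\<^sub>R y\<close> is at most
  \<open>y \<bullet> x - (1 / c) * (norm y)\<^sup>2\<close>. It yields both the kernel property and
  the scaling constant of the square root.\<close>

lemma psd_norm_le:
  fixes P :: "complex^'n^'n"
  assumes "psd P"
  shows "\<exists>c>0. \<forall>x. (norm (P *v x))\<^sup>2 \<le> c * ((P *v x) \<bullet> x)"
proof -
  obtain c where c: "c > 0" "\<And>x. norm (P *v x) \<le> norm x * c"
    using bounded_linear.pos_bounded matrix_vector_mul_linear linear_conv_bounded_linear by blast
  have "(norm (P *v x))\<^sup>2 \<le> c * ((P *v x) \<bullet> x)" for x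
  proof -
    define y where "y = P *v x"
    have "0 \<le> (P *v (x - (1 / c) *\<^sub>R y)) \<bullet> (x - (1 / c) *\<^sub>R y)"
      using assms by (simp add: psd_iff)
    also have "\<dots> = y \<bullet> x - (1 / c) * (y \<bullet> y) - (1 / c) * ((P *v y) \<bullet> x) + (1 / c)\<^sup>2 * ((P *v y) \<bullet> y)"
      by (simp add: matrix_vector_mult_diff_distrib matrix_vector_scaleR y_def[symmetric]
          inner_diff_left inner_diff_right power2_eq_square algebra_simps)
    also have "(P *v y) \<bullet> x = y \<bullet> y"
      using assms by (simp add: inner_matrix_left psd_iff y_def[symmetric])
    also have "(P *v y) \<bullet> y \<le> norm y * c * norm y"
      using norm_cauchy_schwarz[of "P *v y" y] c(2)[of y] mult_right_mono[OF c(2)[of y] norm_ge_zero[of y]] by linarith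
    finally have "0 \<le> y \<bullet> x - (1 / c) * (y \<bullet> y) - (1 / c) * (y \<bullet> y) + (1 / c)\<^sup>2 * (norm y * c * norm y)"
      by (simp add: mult_left_mono)
    also have "\<dots> = y \<bullet> x - (1 / c) * (norm y)\<^sup>2"
      using c(1) by (simp add: dot_square_norm power2_eq_square field_simps)
    finally show ?thesis
      using c(1) by (simp add: y_def[symmetric] field_simps)
  qed
  with c(1) show ?thesis
    by blast
qed

lemma psd_kernel:
  fixes P :: "complex^'n^'n"
  assumes "psd P" "(P *v x) \<bullet> x = 0"
  shows "P *v x = 0"
proof -
  obtain c where "(norm (P *v x))\<^sup>2 \<le> c * ((P *v x) \<bullet> x)"
    using psd_norm_le[OF assms(1)] by blast
  with assms(2) show ?thesis
    by simp
qed

text \<open>The columns are images of unit vectors, so all entries have modulus at most 1. This is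
  the boundedness half of the compactness that Brouwer's theorem asks for.\<close>

lemma bounded_norm_decreasing_matrices:
  "bounded {Y :: complex^'n^'n. \<forall>x. norm (Y *v x) \<le> norm x}"
proof (rule boundedI)
  fix Y :: "complex^'n^'n"
  assume Y: "Y \<in> {Y. \<forall>x. norm (Y *v x) \<le> norm x}"
  have "norm (Y $ i $ j) \<le> 1" for i j
  proof -
    have "norm (Y $ i $ j) = norm ((Y *v axis j 1) $ i)"
      by (simp add: matrix_vector_axis_nth)
    also have "\<dots> \<le> norm (Y *v axis j 1)"
      by (rule Finite_Cartesian_Product.norm_nth_le)
    also have "\<dots> \<le> 1"
      using Y by (auto simp: norm_axis_1 dest: spec[of _ "axis j 1"])
    finally show ?thesis .
  qed
  then have "norm (Y $ i) \<le> (\<Sum>j\<in>(UNIV :: 'n set). 1)" for i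
    unfolding norm_vec_def by (intro order_trans[OF L2_set_le_sum] sum_mono) auto
  then show "norm Y \<le> (\<Sum>i\<in>(UNIV :: 'n set). \<Sum>j\<in>(UNIV :: 'n set). 1)"
    unfolding norm_vec_def[of Y] by (intro order_trans[OF L2_set_le_sum] sum_mono) auto
qed

text \<open>
  After scaling, \<open>P = c (1 - T)\<close> with \<open>T\<close> norm decreasing, and
  \<open>sqrt c (1 - Y)\<close> is a square root of \<open>P\<close> when \<open>2 Y = T + Y\<^sup>2\<close>. Brouwer's theorem yields such a \<open>Y\<close>.
\<close>

lemma psd_sqrt_exists:
  fixes P :: "complex^'n^'n"
  assumes "psd P"
  shows "\<exists>S. psd S \<and> S ** S = P"
proof -
  obtain c where c: "c > 0" "\<And>x. (norm (P *v x))\<^sup>2 \<le> c * ((P *v x) \<bullet> x)"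
    using psd_norm_le[OF assms] by blast
  define T where "T = mat 1 - (1 / c) *\<^sub>R P"
  \<comment> \<open>The fixed point is sought among self-adjoint norm decreasing matrices, a compact
    convex set that \<open>F\<close> preserves because it averages \<open>T\<close> and
    \<open>Y ** Y\<close>. Norm decrease also makes \<open>mat 1 - Y\<close>, hence
    \<open>S\<close>, positive semidefinite.\<close>
  define K where "K = {Y :: complex^'n^'n. ctranspose Y = Y \<and> (\<forall>x. norm (Y *v x) \<le> norm x)}"
  define F where "F = (\<lambda>Y :: complex^'n^'n. (1 / 2) *\<^sub>R (T + Y ** Y))"
  have T_vec: "T *v x = x - (1 / c) *\<^sub>R (P *v x)" for x
    by (simp add: T_def matrix_vector_mult_diff_rdistrib scaleR_matrix_vector)
  have "norm (T *v x) \<le> norm x" for x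
  proof -
    have "(norm (T *v x))\<^sup>2 = (norm x)\<^sup>2 - (2 / c) * ((P *v x) \<bullet> x) + (1 / c)\<^sup>2 * (norm (P *v x))\<^sup>2"
      unfolding T_vec power2_norm_eq_inner by (simp add: inner_diff_left inner_diff_right inner_commute
          power2_eq_square algebra_simps)
    also have "\<dots> \<le> (norm x)\<^sup>2 - (2 / c) * ((P *v x) \<bullet> x) + (1 / c)\<^sup>2 * (c * ((P *v x) \<bullet> x))"
      using c(2)[of x] by (intro add_left_mono mult_left_mono) auto
    also have "\<dots> = (norm x)\<^sup>2 - (1 / c) * ((P *v x) \<bullet> x)"
      using c(1) by (simp add: power2_eq_square field_simps)
    also have "\<dots> \<le> (norm x)\<^sup>2"
      using c(1) assms by (simp add: psd_iff)
    finally show ?thesis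
      by (rule power2_le_imp_le) simp
  qed
  moreover have "ctranspose T = T"
    using assms by (simp add: T_def ctranspose_diff ctranspose_scaleR psd_iff)
  ultimately have TK: "T \<in> K"
    by (simp add: K_def)
  have "closed {Y :: complex^'n^'n. ctranspose Y = Y}"
    unfolding ctranspose_def by (intro closed_Collect_eq continuous_intros)
  moreover have "closed {Y :: complex^'n^'n. \<forall>x. norm (Y *v x) \<le> norm x}"
    unfolding matrix_vector_mult_def by (intro closed_Collect_all closed_Collect_le continuous_intros)
  ultimately have "closed K"
    unfolding K_def by (rule closed_Collect_conj)
  moreover have "bounded K"
    by (rule bounded_subset[OF bounded_norm_decreasing_matrices]) (auto simp: K_def)
  ultimately have "compact K"
    by (simp add: compact_eq_bounded_closed)
  moreover have "convex K"
  proof (rule convexI)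
    fix Y Z :: "complex^'n^'n" and u v :: real
    assume YZ: "Y \<in> K" "Z \<in> K" and uv: "0 \<le> u" "0 \<le> v" "u + v = 1"
    have "norm ((u *\<^sub>R Y + v *\<^sub>R Z) *v x) \<le> norm x" for x
    proof -
      have "norm ((u *\<^sub>R Y + v *\<^sub>R Z) *v x) \<le> u * norm (Y *v x) + v * norm (Z *v x)"
        using uv norm_triangle_ineq[of "u *\<^sub>R (Y *v x)" "v *\<^sub>R (Z *v x)"]
        by (simp add: matrix_vector_mult_add_rdistrib scaleR_matrix_vector)
      also have "\<dots> \<le> u * norm x + v * norm x"
        using uv YZ by (intro add_mono mult_left_mono) (auto simp: K_def)
      also have "\<dots> = norm x"
        using uv by (simp flip: distrib_right)
      finally show ?thesis .
    qed
    with YZ show "u *\<^sub>R Y + v *\<^sub>R Z \<in> K"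
      by (simp add: K_def ctranspose_add ctranspose_scaleR)
  qed
  moreover have "K \<noteq> {}"
    using TK by blast
  moreover have "continuous_on K F"
    unfolding F_def matrix_matrix_mult_def by (intro continuous_intros)
  moreover have "F \<in> K \<rightarrow> K"
  proof
    fix Y
    assume Y: "Y \<in> K"
    have "norm (F Y *v x) \<le> norm x" for x
    proof -
      have "norm (Y *v (Y *v x)) \<le> norm x"
        using Y order_trans[of "norm (Y *v (Y *v x))" "norm (Y *v x)"] by (simp add: K_def)
      moreover have "norm (T *v x) \<le> norm x"
        using TK by (simp add: K_def)
      ultimately show ?thesis
        using norm_triangle_ineq[of "T *v x" "Y *v (Y *v x)"]
        by (simp add: F_def scaleR_matrix_vector matrix_vector_mult_add_rdistrib matrix_vector_mul_assoc)
    qed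
    with Y TK show "F Y \<in> K"
      by (simp add: K_def F_def ctranspose_add ctranspose_scaleR ctranspose_matrix_mul)
  qed
  ultimately obtain Y where Y: "Y \<in> K" "F Y = Y"
    by (rule brouwer)
  define S where "S = sqrt c *\<^sub>R (mat 1 - Y)"
  have S_vec: "S *v x = sqrt c *\<^sub>R (x - Y *v x)" for x
    by (simp add: S_def scaleR_matrix_vector matrix_vector_mult_diff_rdistrib)
  have YY: "Y *v (Y *v x) = 2 *\<^sub>R (Y *v x) - T *v x" for x
  proof -
    have "2 *\<^sub>R (Y *v x) = 2 *\<^sub>R (F Y *v x)"
      by (simp add: Y(2))
    also have "\<dots> = T *v x + Y *v (Y *v x)"
      by (simp add: F_def scaleR_matrix_vector matrix_vector_mult_add_rdistrib matrix_vector_mul_assoc)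
    finally show ?thesis
      by simp
  qed
  have "S *v (S *v x) = P *v x" for x
  proof -
    have "S *v (S *v x) = c *\<^sub>R ((x - Y *v x) - (Y *v x - Y *v (Y *v x)))"
      using c(1) by (simp add: S_vec matrix_vector_scaleR matrix_vector_mult_diff_distrib flip: scaleR_diff_right)
    also have "\<dots> = c *\<^sub>R (x - T *v x)"
      by (simp add: YY scaleR_2)
    also have "\<dots> = P *v x"
      using c(1) by (simp add: T_vec)
    finally show ?thesis .
  qed
  then have "S ** S = P"
    by (simp add: matrix_eq flip: matrix_vector_mul_assoc)
  moreover have "psd S"
    unfolding psd_iff
  proof (intro conjI allI)
    show "ctranspose S = S"
      using Y(1) by (simp add: S_def K_def ctranspose_scaleR ctranspose_diff)
    fix x
    have "(Y *v x) \<bullet> x \<le> norm (Y *v x) * norm x"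
      by (rule norm_cauchy_schwarz)
    also have "\<dots> \<le> norm x * norm x"
      using Y(1) by (intro mult_right_mono) (auto simp: K_def)
    finally show "0 \<le> (S *v x) \<bullet> x"
      using c(1) by (simp add: S_vec inner_diff_left dot_square_norm power2_eq_square)
  qed
  ultimately show ?thesis
    by blast
qed

section \<open>Uniqueness of the positive semidefinite square root\<close>

lemma Re_trace_conj:
  fixes D S :: "complex^'n^'n"
  assumes "ctranspose D = D"
  shows "Re (trace (D ** (S ** D))) = (\<Sum>i\<in>UNIV. (S *v (D *v axis i 1)) \<bullet> (D *v axis i 1))"
proof -
  have "M $ i $ i = cinner (M *v axis i 1) (axis i 1)" for M :: "complex^'n^'n" and i
    by (simp add: cinner_def matrix_vector_axis_nth)
      (simp add: axis_def if_distrib[of cnj] if_distrib[of "\<lambda>c. c * _"] cong: if_cong)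
  then have "Re ((D ** (S ** D)) $ i $ i) = (S *v (D *v axis i 1)) \<bullet> (D *v axis i 1)" for i
    using assms by (simp add: Re_cinner inner_matrix_left flip: matrix_vector_mul_assoc)
  then show ?thesis
    by (simp add: trace_def)
qed

text \<open>The trace sums the nonnegative values of the form of \<open>S\<close> at the columns of
  \<open>D\<close>. So each value is 0, and \<open>psd_kernel\<close> turns this into annihilation
  of the columns.\<close>

lemma psd_trace_conj_eq_0:
  fixes D S :: "complex^'n^'n"
  assumes "ctranspose D = D" "psd S" "Re (trace (D ** (S ** D))) \<le> 0"
  shows "S ** D = 0"
proof -
  have nonneg: "0 \<le> (S *v (D *v axis i 1)) \<bullet> (D *v axis i 1)" for i
    using assms(2) by (simp add: psd_iff)
  then have "(\<Sum>i\<in>UNIV. (S *v (D *v axis i 1)) \<bullet> (D *v axis i 1)) = 0"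
    using assms(3) unfolding Re_trace_conj[OF assms(1)] by (intro antisym sum_nonneg) auto
  then have "(S *v (D *v axis i 1)) \<bullet> (D *v axis i 1) = 0" for i
    using nonneg by (simp add: sum_nonneg_eq_0_iff)
  then have "S *v (D *v axis i 1) = 0" for i
    using psd_kernel[OF assms(2)] by blast
  then have "(S ** D) $ j $ i = 0" for i j
    by (metis matrix_vector_axis_nth matrix_vector_mul_assoc zero_index)
  then show ?thesis
    by (simp add: vec_eq_iff)
qed

text \<open>\<open>S\<close> and \<open>S'\<close> may fail to commute, so with
  \<open>D = S - S'\<close> the difference of squares is split as
  \<open>S ** D + D ** S' = 0\<close>. Multiplying by \<open>D\<close> and taking traces gives two
  nonnegative numbers with sum 0; thus \<open>S\<close> and \<open>S'\<close> both annihilate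
  \<open>D\<close>, whence \<open>D ** D = 0\<close> and the self-adjoint \<open>D\<close>
  vanishes.\<close>

lemma psd_sqrt_unique:
  fixes S S' :: "complex^'n^'n"
  assumes "psd S" "psd S'" "S ** S = S' ** S'"
  shows "S = S'"
proof -
  define D where "D = S - S'"
  have D: "ctranspose D = D"
    using assms by (simp add: D_def ctranspose_diff psd_iff)
  have mdl: "A ** (B - C) = A ** B - A ** C" and mdr: "(B - C) ** A = B ** A - C ** A" for A B C :: "complex^'n^'n"
    by (simp_all add: matrix_matrix_mult_def vec_eq_iff algebra_simps sum_subtractf)
  have "S ** D + D ** S' = 0"
    using assms(3) by (simp add: D_def mdl mdr)
  then have "trace (D ** (S ** D + D ** S')) = 0"
    by (simp add: trace_def)
  then have "trace (D ** (S ** D)) + trace (D ** (D ** S')) = 0"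
    by (simp add: matrix_add_ldistrib trace_add)
  also have "trace (D ** (D ** S')) = trace (D ** (S' ** D))"
    by (metis trace_mul_sym matrix_mul_assoc)
  finally have "Re (trace (D ** (S ** D))) + Re (trace (D ** (S' ** D))) = 0"
    by (metis plus_complex.sel(1) zero_complex.sel(1))
  moreover have "0 \<le> Re (trace (D ** (S ** D)))" "0 \<le> Re (trace (D ** (S' ** D)))"
    using assms unfolding Re_trace_conj[OF D] by (auto simp: psd_iff intro!: sum_nonneg)
  ultimately have "S ** D = 0" "S' ** D = 0"
    using assms D by (auto intro!: psd_trace_conj_eq_0)
  then have "D ** D = 0"
    by (subst (1) D_def) (simp add: mdr)
  have "D *v x = 0" for x
  proof -
    have "(D *v x) \<bullet> (D *v x) = x \<bullet> (D *v (D *v x))"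
      by (simp add: inner_matrix_left D)
    also have "\<dots> = 0"
      by (simp add: matrix_vector_mul_assoc \<open>D ** D = 0\<close>)
    finally show ?thesis
      by simp
  qed
  then have "D = 0"
    by (simp add: matrix_eq)
  then show ?thesis
    by (simp add: D_def)
qed

lemma psd_sqrt_correct:
  fixes P :: "complex^'n^'n"
  assumes "psd P"
  shows "psd (psd_sqrt P)" "psd_sqrt P ** psd_sqrt P = P"
proof -
  have "\<exists>!S. psd S \<and> S ** S = P"
    using psd_sqrt_exists[OF assms] psd_sqrt_unique by metis
  then have "psd (psd_sqrt P) \<and> psd_sqrt P ** psd_sqrt P = P"
    unfolding psd_sqrt_def by (rule theI')
  then show "psd (psd_sqrt P)" "psd_sqrt P ** psd_sqrt P = P"
    by auto
qed

section \<open>The resolvent and the Yosida extension\<close>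

text \<open>Near 0 continuity bounds the difference by \<eta>; for \<open>t \<ge> d\<close> the
  bound \<open>2 * B\<close> is at most \<open>(2 * B / d) * t\<close>. A linear majorant is wanted
  because, once compared with the travel time, it can be integrated against the Laplace kernel
  explicitly.\<close>

lemma continuous_le_affine:
  fixes h :: "real \<Rightarrow> 'a::real_normed_vector"
  assumes "continuous_on {0..1} h" "\<eta> > 0"
  shows "\<exists>C\<ge>0. \<forall>t\<in>{0..1}. norm (h t - h 0) \<le> \<eta> + C * t"
proof -
  obtain d where d: "d > 0" "\<And>t. t \<in> {0..1} \<Longrightarrow> \<bar>t - 0\<bar> < d \<Longrightarrow> norm (h t - h 0) < \<eta>"
    using assms unfolding continuous_on_iff dist_norm
    by (metis atLeastAtMost_iff order_refl real_norm_def zero_le_one)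
  have "bounded (h ` {0..1})"
    using assms(1) by (intro compact_imp_bounded compact_continuous_image) auto
  then obtain B where B: "\<And>t. t \<in> {0..1} \<Longrightarrow> norm (h t) \<le> B"
    unfolding bounded_iff by blast
  have "B \<ge> 0"
    using B[of 0] order_trans[OF norm_ge_zero[of "h 0"]] by simp
  have "norm (h t - h 0) \<le> \<eta> + (2 * B / d) * t" if t: "t \<in> {0..1}" for t
  proof (cases "t < d")
    case True
    then have "norm (h t - h 0) < \<eta>"
      using d(2) t by simp
    moreover have "0 \<le> (2 * B / d) * t"
      using t d(1) \<open>B \<ge> 0\<close> by simp
    ultimately show ?thesis
      by simp
  next
    case False
    then have "2 * B \<le> (2 * B / d) * t"
      using d(1) \<open>B \<ge> 0\<close> mult_left_mono[of d t "2 * B"] by (simp add: field_simps)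
    moreover have "norm (h t - h 0) \<le> 2 * B"
      using norm_triangle_ineq4[of "h t" "h 0"] B[OF t] B[of 0] by simp
    ultimately show ?thesis
      using assms(2) by simp
  qed
  moreover have "0 \<le> 2 * B / d"
    using d(1) \<open>B \<ge> 0\<close> by simp
  ultimately show ?thesis
    by blast
qed

locale weight =
  fixes lam :: "real \<Rightarrow> real" and \<epsilon> M :: real
  assumes lam_measurable: "lam \<in> borel_measurable unit_leb"
    and eps_pos: "0 < \<epsilon>"
    and lam_ge: "\<And>x. x \<in> {0..1} \<Longrightarrow> \<epsilon> \<le> lam x"
    and lam_le: "\<And>x. x \<in> {0..1} \<Longrightarrow> lam x \<le> M"
begin

lemma lam_pos: "x \<in> {0..1} \<Longrightarrow> 0 < lam x"
  using eps_pos lam_ge[of x] by simp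

lemma M_pos: "0 < M"
  using lam_pos[of 0] lam_le[of 0] by simp

lemma inv_lam_bound: "x \<in> {0..1} \<Longrightarrow> \<bar>1 / lam x\<bar> \<le> 1 / \<epsilon>"
  using lam_pos[of x] lam_ge[of x] eps_pos by (simp add: frac_le)

lemma inv_lam_measurable: "(\<lambda>x. 1 / lam x) \<in> borel_measurable unit_leb"
  using lam_measurable by simp

lemma inv_lam_abs_integrable: "(\<lambda>x. 1 / lam x) absolutely_integrable_on {0..1}"
proof (rule measurable_bounded_by_integrable_imp_absolutely_integrable)
  show "(\<lambda>_. 1 / \<epsilon>) integrable_on {0..1::real}"
    by (intro integrable_continuous_real continuous_on_const)
qed (use inv_lam_measurable inv_lam_bound in simp_all)

text \<open>The time a signal of speed \<open>lam\<close> takes from 0 to \<open>x\<close>. As the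
  weight is merely measurable, its derivative is \<open>1 / lam\<close> in the sense of
  \<open>AC\<close>, and its exponentials are differentiated by \<open>AC_chain\<close>.\<close>

definition travel :: "real \<Rightarrow> real"
  where "travel x = integral {0..x} (\<lambda>t. 1 / lam t)"

lemma travel_0 [simp]: "travel 0 = 0"
  by (simp add: travel_def)

lemma AC_travel: "AC travel (\<lambda>x. 1 / lam x)"
  using AC_I[OF inv_lam_abs_integrable, of 0] by (simp add: travel_def[abs_def])

text \<open>Comes from \<open>lam \<le> M\<close>. At \<open>x = 1\<close> it makes
  \<open>exp (- s * travel 1)\<close> decay; for general \<open>x\<close> it converts an error
  linear in \<open>x\<close> into one linear in \<open>travel x\<close>.\<close>

lemma travel_ge:
  assumes "x \<in> {0..1}"
  shows "x \<le> M * travel x"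
proof -
  have "x / M = integral {0..x} (\<lambda>_. 1 / M)"
    using assms by simp
  also have "\<dots> \<le> travel x"
    unfolding travel_def
  proof (rule integral_le)
    show "(\<lambda>t. 1 / lam t) integrable_on {0..x}"
      using abs_integrable_imp_integrable_sub[OF inv_lam_abs_integrable] assms by simp
    show "1 / M \<le> 1 / lam t" if "t \<in> {0..x}" for t
      using that assms lam_pos[of t] lam_le[of t] by (intro divide_left_mono) auto
  qed (intro integrable_continuous_real continuous_on_const)
  finally show ?thesis
    using M_pos by (simp add: field_simps)
qed

lemma travel_1_pos: "0 < travel 1"
  using travel_ge[of 1] M_pos by (metis atLeastAtMost_iff less_le_trans order_refl zero_less_mult_pos zero_less_one zero_le_one)

lemma AC_exp_travel: "AC (\<lambda>x. exp (s * travel x)) (\<lambda>x. s * exp (s * travel x) * (1 / lam x))"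
  by (rule AC_chain[OF AC_travel, where \<Phi> = "\<lambda>y. exp (s * y)" and \<Phi>' = "\<lambda>y. s * exp (s * y)"])
    (auto intro!: derivative_eq_intros continuous_intros)

lemma integral_exp_travel:
  "((\<lambda>x. s * exp (- s * travel x) * (1 / lam x)) has_integral 1 - exp (- s * travel 1)) {0..1}"
proof -
  have "AC (\<lambda>x. - exp (- s * travel x)) (\<lambda>x. - (- s * exp (- s * travel x) * (1 / lam x)))"
    by (rule AC_minus[OF AC_exp_travel])
  then have AC: "AC (\<lambda>x. - exp (- s * travel x)) (\<lambda>x. s * exp (- s * travel x) * (1 / lam x))"
    by simp
  then show ?thesis
    using AC_diff[OF AC, of 0 1] abs_integrable_imp_integrable_sub[OF AC_integrable[OF AC], of 0 1]
    by (simp add: has_integral_iff)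
qed

text \<open>First moment of the kernel in the travel time variable. Its order \<open>1 / s\<close>
  is what the limit uses, so the exact value is hidden behind \<open>I\<close>.\<close>

lemma integral_exp_travel_mult:
  assumes "s > 0"
  obtains I where "((\<lambda>x. s * travel x * exp (- s * travel x) * (1 / lam x)) has_integral I) {0..1}" "I \<le> 1 / s"
proof -
  \<comment> \<open>An antiderivative of \<open>s * y * exp (- s * y)\<close> on the time axis,
    before \<open>travel x\<close> is substituted for \<open>y\<close>.\<close>
  have deriv: "((\<lambda>y. - (y + 1 / s) * exp (- s * y)) has_field_derivative s * y * exp (- s * y)) (at y)" for y
    using assms by (auto intro!: derivative_eq_intros simp: field_simps)
  have AC: "AC (\<lambda>x. - (travel x + 1 / s) * exp (- s * travel x)) (\<lambda>x. s * travel x * exp (- s * travel x) * (1 / lam x))"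
    by (rule AC_chain[OF AC_travel, where \<Phi> = "\<lambda>y. - (y + 1 / s) * exp (- s * y)"
          and \<Phi>' = "\<lambda>y. s * y * exp (- s * y)", OF deriv]) (intro continuous_intros)
  show ?thesis
  proof
    show "((\<lambda>x. s * travel x * exp (- s * travel x) * (1 / lam x)) has_integral
        1 / s - (travel 1 + 1 / s) * exp (- s * travel 1)) {0..1}"
    proof -
      have "integral {0..1} (\<lambda>x. s * travel x * exp (- s * travel x) * (1 / lam x))
          = - (travel 1 + 1 / s) * exp (- s * travel 1) - - (travel 0 + 1 / s) * exp (- s * travel 0)"
        by (rule AC_diff[OF AC, symmetric]) auto
      also have "\<dots> = 1 / s - (travel 1 + 1 / s) * exp (- s * travel 1)"
        by (simp add: algebra_simps)
      finally show ?thesis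
        using abs_integrable_imp_integrable_sub[OF AC_integrable[OF AC], of 0 1]
        by (simp only: has_integral_iff)
    qed
    show "1 / s - (travel 1 + 1 / s) * exp (- s * travel 1) \<le> 1 / s"
      using assms travel_1_pos by simp
  qed
qed

lemma exp_travel_tendsto: "((\<lambda>s. exp (- s * travel 1)) \<longlongrightarrow> 0) at_top"
proof -
  have "filterlim (\<lambda>s. travel 1 * s) at_top at_top"
    by (rule filterlim_tendsto_pos_mult_at_top[OF tendsto_const travel_1_pos filterlim_ident])
  then have "filterlim (\<lambda>s. - (travel 1 * s)) at_bot at_top"
    by (simp add: filterlim_uminus_at_bot)
  from filterlim_compose[OF exp_at_bot this] show ?thesis
    by (simp add: mult.commute)
qed

text \<open>
  The kernel \<open>s exp (- s travel) / lam\<close> has total mass tending to 1 and concentrates at 0;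
  \<open>norm (h - h 0) \<le> \<eta> + C M travel\<close> turns the error into integrals known in closed form.
\<close>

lemma laplace_tendsto:
  fixes h :: "real \<Rightarrow> 'a::euclidean_space"
  assumes h: "continuous_on {0..1} h"
  shows "((\<lambda>s. integral {0..1} (\<lambda>x. (s * exp (- s * travel x) * (1 / lam x)) *\<^sub>R h x)) \<longlongrightarrow> h 0) at_top"
proof (rule tendstoI)
  fix e :: real
  assume "e > 0"
  define k where "k = (\<lambda>s x. s * exp (- s * travel x) * (1 / lam x))"
  \<comment> \<open>Half of \<open>e\<close> is spent on the continuity of \<open>h\<close>.
    \<open>C\<close> depends on \<open>e\<close> but not on \<open>s\<close>, so the term it
    multiplies still vanishes in the limit.\<close>
  obtain C where C: "C \<ge> 0" "\<And>t. t \<in> {0..1} \<Longrightarrow> norm (h t - h 0) \<le> e / 2 + C * t"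
    using continuous_le_affine[OF h, of "e / 2"] \<open>e > 0\<close> by auto
  have bound: "norm (integral {0..1} (\<lambda>x. k s x *\<^sub>R h x) - h 0) \<le> e / 2 + (C * M * (1 / s) + exp (- s * travel 1) * norm (h 0))"
    if s: "s > 0" for s
  proof -
    obtain I where I: "((\<lambda>x. s * travel x * exp (- s * travel x) * (1 / lam x)) has_integral I) {0..1}" "I \<le> 1 / s"
      using integral_exp_travel_mult[OF s] by blast
    have k: "(k s has_integral 1 - exp (- s * travel 1)) {0..1}"
      unfolding k_def by (rule integral_exp_travel)
    have kh0: "((\<lambda>x. k s x *\<^sub>R h 0) has_integral (1 - exp (- s * travel 1)) *\<^sub>R h 0) {0..1}"
      using k by (rule has_integral_scaleR_left)
    have kh: "(\<lambda>x. k s x *\<^sub>R h x) integrable_on {0..1}"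
    proof -
      have "k s absolutely_integrable_on {0..1}"
        using AC_integrable[OF AC_minus[OF AC_exp_travel[of "- s"]]] by (simp add: k_def)
      then show ?thesis
        using abs_integrable_continuous_bilinear[OF bounded_bilinear.flip[OF bounded_bilinear_scaleR] h]
        by (simp add: set_lebesgue_integral_eq_integral(1))
    qed
    have diff: "((\<lambda>x. k s x *\<^sub>R h x - k s x *\<^sub>R h 0) has_integral
        integral {0..1} (\<lambda>x. k s x *\<^sub>R h x) - (1 - exp (- s * travel 1)) *\<^sub>R h 0) {0..1}"
      using kh kh0 by (intro has_integral_diff integrable_integral)
    have maj: "((\<lambda>x. (e / 2) * k s x + (C * M) * (s * travel x * exp (- s * travel x) * (1 / lam x))) has_integral
        (e / 2) * (1 - exp (- s * travel 1)) + (C * M) * I) {0..1}"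
      using k I(1) by (intro has_integral_add has_integral_mult_right)
    have "norm (integral {0..1} (\<lambda>x. k s x *\<^sub>R h x) - (1 - exp (- s * travel 1)) *\<^sub>R h 0)
        \<le> (e / 2) * (1 - exp (- s * travel 1)) + (C * M) * I"
      unfolding integral_unique[OF diff, symmetric] integral_unique[OF maj, symmetric]
    proof (rule integral_norm_bound_integral)
      show "(\<lambda>x. k s x *\<^sub>R h x - k s x *\<^sub>R h 0) integrable_on {0..1}"
        using diff by blast
      show "(\<lambda>x. (e / 2) * k s x + (C * M) * (s * travel x * exp (- s * travel x) * (1 / lam x))) integrable_on {0..1}"
        using maj by blast
      fix x :: real
      assume x: "x \<in> {0..1}"
      have kpos: "0 \<le> k s x"
        using s lam_pos[OF x] by (simp add: k_def)
      have "norm (h x - h 0) \<le> e / 2 + C * M * travel x"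
        using C(2)[OF x] mult_left_mono[OF travel_ge[OF x] C(1)] by (simp add: mult.assoc)
      then have "norm (k s x *\<^sub>R (h x - h 0)) \<le> k s x * (e / 2 + C * M * travel x)"
        using kpos by (simp add: mult_left_mono)
      then show "norm (k s x *\<^sub>R h x - k s x *\<^sub>R h 0)
          \<le> (e / 2) * k s x + (C * M) * (s * travel x * exp (- s * travel x) * (1 / lam x))"
        by (simp add: scaleR_diff_right) (simp add: k_def algebra_simps)
    qed
    also have "\<dots> \<le> e / 2 + C * M * (1 / s)"
    proof (rule add_mono)
      show "(e / 2) * (1 - exp (- s * travel 1)) \<le> e / 2"
        using \<open>e > 0\<close> by (intro mult_left_le) auto
      show "C * M * I \<le> C * M * (1 / s)"
        using I(2) C(1) M_pos by (intro mult_left_mono) auto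
    qed
    finally have main: "norm (integral {0..1} (\<lambda>x. k s x *\<^sub>R h x) - (1 - exp (- s * travel 1)) *\<^sub>R h 0) \<le> e / 2 + C * M * (1 / s)" .
    \<comment> \<open>The kernel has mass \<open>1 - q\<close> with
      \<open>q = exp (- s * travel 1)\<close>, so the average was compared with
      \<open>(1 - q) *\<^sub>R h 0\<close>; the missing mass costs
      \<open>q * norm (h 0)\<close>.\<close>
    have "norm (v - h 0) \<le> norm (v - (1 - q) *\<^sub>R h 0) + q * norm (h 0)" if "q \<ge> 0" for v q
    proof -
      have "v - h 0 = (v - (1 - q) *\<^sub>R h 0) - q *\<^sub>R h 0"
        by (simp add: scaleR_diff_left)
      then have "norm (v - h 0) = norm ((v - (1 - q) *\<^sub>R h 0) - q *\<^sub>R h 0)"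
        by (rule arg_cong)
      also have "\<dots> \<le> norm (v - (1 - q) *\<^sub>R h 0) + norm (q *\<^sub>R h 0)"
        by (rule norm_triangle_ineq4)
      finally show ?thesis
        using that by simp
    qed
    from order_trans[OF this[OF exp_ge_zero] add_right_mono[OF main]] show ?thesis
      by (simp only: add.assoc)
  qed
  have "((\<lambda>s. C * M * (1 / s) + exp (- s * travel 1) * norm (h 0)) \<longlongrightarrow> C * M * 0 + 0 * norm (h 0)) at_top"
    by (intro tendsto_add tendsto_mult tendsto_const exp_travel_tendsto tendsto_divide_0[OF tendsto_const]
        filterlim_at_top_imp_at_infinity filterlim_ident)
  then have "\<forall>\<^sub>F s in at_top. C * M * (1 / s) + exp (- s * travel 1) * norm (h 0) < e / 2"
    using \<open>e > 0\<close> by (intro order_tendstoD(2)[where y = 0]) simp_all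
  then show "\<forall>\<^sub>F s in at_top. dist (integral {0..1} (\<lambda>x. (s * exp (- s * travel x) * (1 / lam x)) *\<^sub>R h x)) (h 0) < e"
    using eventually_gt_at_top[of 0]
  proof eventually_elim
    case (elim s)
    have "norm (integral {0..1} (\<lambda>x. k s x *\<^sub>R h x) - h 0) < e"
      using bound[OF elim(2)] elim(1) by linarith
    then show ?case
      unfolding dist_norm k_def .
  qed
qed

section \<open>The resolvent equation of the adjoint\<close>

lemma resolvent_AC_boundary:
  fixes \<phi> g :: "real \<Rightarrow> complex^'n"
  assumes "AC \<phi> (\<lambda>x. (s / lam x) *\<^sub>R \<phi> x - g x)"
  shows "\<phi> 0 = exp (- s * travel 1) *\<^sub>R \<phi> 1 + integral {0..1} (\<lambda>x. exp (- s * travel x) *\<^sub>R g x)"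
proof -
  \<comment> \<open>\<open>exp (- s * travel x)\<close> is the integrating factor: the terms with
    \<open>\<phi> x\<close> cancel and only the source \<open>g\<close> is left to
    integrate.\<close>
  have AC: "AC (\<lambda>x. exp (- s * travel x) *\<^sub>R \<phi> x)
      (\<lambda>x. (- s * exp (- s * travel x) * (1 / lam x)) *\<^sub>R \<phi> x + exp (- s * travel x) *\<^sub>R ((s / lam x) *\<^sub>R \<phi> x - g x))"
    by (rule AC_bilinear[OF bounded_bilinear_scaleR AC_exp_travel assms])
  have "exp (- s * travel 1) *\<^sub>R \<phi> 1 - \<phi> 0 = integral {0..1} (\<lambda>x. - (exp (- s * travel x) *\<^sub>R g x))"
    using AC_diff[OF AC, of 0 1] by (simp add: algebra_simps)
  also have "\<dots> = - integral {0..1} (\<lambda>x. exp (- s * travel x) *\<^sub>R g x)"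
    by simp
  finally show ?thesis
    by (simp add: algebra_simps)
qed

text \<open>Variation of constants, with \<open>G\<close> in the role of \<phi> times the
  integrating factor. The end values \<open>c\<close> and \<open>d\<close> are tied by the relation
  of \<open>resolvent_AC_boundary\<close> alone, so that the boundary condition can be imposed
  afterwards.\<close>

lemma resolvent_AC_exists:
  fixes g :: "real \<Rightarrow> complex^'n"
  assumes g: "g absolutely_integrable_on {0..1}"
    and c: "c = exp (- s * travel 1) *\<^sub>R d + integral {0..1} (\<lambda>x. exp (- s * travel x) *\<^sub>R g x)"
  obtains \<phi> where "AC \<phi> (\<lambda>x. (s / lam x) *\<^sub>R \<phi> x - g x)" "\<phi> 0 = c" "\<phi> 1 = d"
proof -
  define G where "G = (\<lambda>x. c + integral {0..x} (\<lambda>t. - (exp (- s * travel t) *\<^sub>R g t)))"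
  have "(\<lambda>t. exp (- s * travel t) *\<^sub>R g t) absolutely_integrable_on {0..1}"
    by (rule abs_integrable_continuous_bilinear[OF bounded_bilinear_scaleR AC_continuous_on[OF AC_exp_travel] g])
  then have G: "AC G (\<lambda>t. - (exp (- s * travel t) *\<^sub>R g t))"
    unfolding G_def by (intro AC_I) (simp add: abs_integrable_on_iff_integrable)
  have "AC (\<lambda>x. exp (s * travel x) *\<^sub>R G x)
      (\<lambda>x. (s * exp (s * travel x) * (1 / lam x)) *\<^sub>R G x + exp (s * travel x) *\<^sub>R - (exp (- s * travel x) *\<^sub>R g x))"
    by (rule AC_bilinear[OF bounded_bilinear_scaleR AC_exp_travel G])
  moreover have "exp (s * travel x) * exp (- (s * travel x)) = 1" for x
    by (simp flip: exp_add)
  ultimately have "AC (\<lambda>x. exp (s * travel x) *\<^sub>R G x) (\<lambda>x. (s / lam x) *\<^sub>R (exp (s * travel x) *\<^sub>R G x) - g x)"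
    by (simp add: mult_ac)
  moreover have "G 1 = exp (- s * travel 1) *\<^sub>R d"
    by (simp add: G_def c)
  then have "exp (s * travel 1) *\<^sub>R G 1 = d"
    by (simp flip: exp_add)
  moreover have "exp (s * travel 0) *\<^sub>R G 0 = c"
    by (simp add: G_def)
  ultimately show ?thesis
    using that[of "\<lambda>x. exp (s * travel x) *\<^sub>R G x"] by blast
qed

lemma inv_lam_scaleR_L2:
  fixes f :: "real \<Rightarrow> complex^'n"
  assumes "f \<in> L2"
  shows "(\<lambda>x. (s / lam x) *\<^sub>R f x) \<in> L2"
proof (rule L2_I_bound[OF _ assms])
  show "(\<lambda>x. (s / lam x) *\<^sub>R f x) \<in> borel_measurable unit_leb"
    using lam_measurable L2_measurable[OF assms] by measurable
  show "norm ((s / lam x) *\<^sub>R f x) \<le> (\<bar>s\<bar> * (1 / \<epsilon>)) * norm (f x)" if "x \<in> {0..1}" for x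
  proof -
    have "\<bar>s / lam x\<bar> = \<bar>s\<bar> * \<bar>1 / lam x\<bar>"
      by simp
    also have "\<dots> \<le> \<bar>s\<bar> * (1 / \<epsilon>)"
      by (rule mult_left_mono[OF inv_lam_bound[OF that] abs_ge_zero])
    finally show ?thesis
      unfolding norm_scaleR by (rule mult_right_mono) simp
  qed
qed

lemma scaled_inv_lam: "x \<in> {0..1} \<Longrightarrow> scaled lam (\<lambda>x. (s / lam x) *\<^sub>R \<phi> x) x = s *\<^sub>R \<phi> x"
  using lam_pos[of x] by (simp add: scaled_def)

text \<open>With the condition \<open>\<phi> 1 = ctranspose Ad *v \<phi> 0\<close>, solvability
  reduces to the linear system \<open>f c = ...\<close> for \<open>c = \<phi> 0\<close>. The
  contraction bound \<open>contr\<close> makes \<open>f\<close> injective, hence surjective in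
  finite dimension. One solution is enough for the choice in \<open>resolvent_A_adj\<close> to be a
  solution.\<close>

lemma resolvent_correct:
  fixes Ad :: "complex^'n^'n" and g :: "real \<Rightarrow> complex^'n"
  assumes g: "g \<in> L2" and contr: "\<And>x. norm (exp (- s * travel 1) *\<^sub>R (ctranspose Ad *v x)) \<le> norm x / 2"
  shows "resolvent_A_adj lam Ad s g \<in> dom_A_adj lam Ad"
    "AE x in unit_leb. s *\<^sub>R resolvent_A_adj lam Ad s g x - op_A_adj lam (resolvent_A_adj lam Ad s g) x = g x"
proof -
  define f where "f = (\<lambda>x. x - exp (- s * travel 1) *\<^sub>R (ctranspose Ad *v x))"
  have lin: "linear f"
    by (rule linearI) (simp_all add: f_def matrix_vector_right_distrib matrix_vector_scaleR algebra_simps)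
  have "inj f"
    unfolding linear_injective_0[OF lin]
  proof (intro allI impI)
    fix x
    assume "f x = 0"
    then have "norm x \<le> norm x / 2"
      using contr[of x] by (simp add: f_def)
    then show "x = 0"
      by simp
  qed
  then have "surj f"
    by (rule linear_inj_imp_surj[OF lin])
  then obtain c where "f c = integral {0..1} (\<lambda>x. exp (- s * travel x) *\<^sub>R g x)"
    by (metis surjD)
  then have c: "c = exp (- s * travel 1) *\<^sub>R (ctranspose Ad *v c) + integral {0..1} (\<lambda>x. exp (- s * travel x) *\<^sub>R g x)"
    by (simp add: f_def algebra_simps)
  obtain \<phi> where \<phi>: "AC \<phi> (\<lambda>x. (s / lam x) *\<^sub>R \<phi> x - g x)" "\<phi> 0 = c" "\<phi> 1 = ctranspose Ad *v c"
    using resolvent_AC_exists[OF L2_abs_integrable[OF g] c] by blast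
  have \<phi>L2: "\<phi> \<in> L2"
    by (rule L2_continuous[OF AC_continuous_on[OF \<phi>(1)]])
  define \<psi> where "\<psi> = (\<lambda>x. (1 / lam x) *\<^sub>R \<phi> x)"
  have \<psi>L2: "\<psi> \<in> L2"
    unfolding \<psi>_def by (rule inv_lam_scaleR_L2[OF \<phi>L2])
  have u: "scaled lam \<psi> x = \<phi> x" if "x \<in> {0..1}" for x
    using scaled_inv_lam[OF that, of 1 \<phi>] by (simp add: \<psi>_def)
  have uL2: "scaled lam \<psi> \<in> L2"
  proof (rule L2_I_bound[OF _ \<phi>L2])
    show "scaled lam \<psi> \<in> borel_measurable unit_leb"
      unfolding scaled_def using lam_measurable L2_measurable[OF \<psi>L2] by (rule borel_measurable_scaleR)
    show "norm (scaled lam \<psi> x) \<le> 1 * norm (\<phi> x)" if "x \<in> {0..1}" for x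
      using u[OF that] by simp
  qed
  have vL2: "(\<lambda>x. (s / lam x) *\<^sub>R \<phi> x - g x) \<in> L2"
    by (rule L2_diff[OF inv_lam_scaleR_L2[OF \<phi>L2] g])
  have AE: "AE x in unit_leb. \<phi> x = scaled lam \<psi> x"
    using u by (intro AE_I2) simp
  note H1 = H1_I_AC[OF uL2 vL2 \<phi>(1) AE]
  have "\<psi> \<in> dom_A_adj lam Ad"
    unfolding dom_A_adj_def using \<psi>L2 H1(1) H1(3)[of 0] H1(3)[of 1] \<phi>(2,3) by simp
  moreover have "AE x in unit_leb. s *\<^sub>R \<psi> x - op_A_adj lam \<psi> x = g x"
    using H1(2) unfolding op_A_adj_def by eventually_elim (simp add: \<psi>_def)
  ultimately have "resolvent_A_adj lam Ad s g \<in> dom_A_adj lam Ad \<and>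
      (AE x in unit_leb. s *\<^sub>R resolvent_A_adj lam Ad s g x - op_A_adj lam (resolvent_A_adj lam Ad s g) x = g x)"
    unfolding resolvent_A_adj_def
    by (intro someI[where P = "\<lambda>\<psi>. \<psi> \<in> dom_A_adj lam Ad \<and> (AE x in unit_leb. s *\<^sub>R \<psi> x - op_A_adj lam \<psi> x = g x)"] conjI)
  then show "resolvent_A_adj lam Ad s g \<in> dom_A_adj lam Ad"
    "AE x in unit_leb. s *\<^sub>R resolvent_A_adj lam Ad s g x - op_A_adj lam (resolvent_A_adj lam Ad s g) x = g x"
    by auto
qed

text \<open>Stated for an arbitrary solution \<psi>, so it applies to whichever one
  \<open>resolvent_A_adj\<close> selects. The equation holds almost everywhere, and
  \<open>AC_AE_cong\<close> exchanges the weak derivative for the density it prescribes.\<close>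

lemma resolvent_trace:
  fixes Ad :: "complex^'n^'n" and g :: "real \<Rightarrow> complex^'n"
  assumes g: "g \<in> L2" and \<psi>: "\<psi> \<in> dom_A_adj lam Ad"
    and eq: "AE x in unit_leb. s *\<^sub>R \<psi> x - op_A_adj lam \<psi> x = g x"
  shows "cont_rep (scaled lam \<psi>) 0 = exp (- s * travel 1) *\<^sub>R (ctranspose Ad *v cont_rep (scaled lam \<psi>) 0)
    + integral {0..1} (\<lambda>x. exp (- s * travel x) *\<^sub>R g x)"
proof -
  define \<phi> where "\<phi> = cont_rep (scaled lam \<psi>)"
  have u: "scaled lam \<psi> \<in> H1" and bc: "\<phi> 1 = ctranspose Ad *v \<phi> 0"
    using \<psi> by (auto simp: dom_A_adj_def \<phi>_def)
  note H1 = H1_AC[OF u, folded \<phi>_def]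
  have \<phi>L2: "\<phi> \<in> L2"
    by (rule L2_continuous[OF AC_continuous_on[OF H1(3)]])
  have "AE x in unit_leb. weak_deriv (scaled lam \<psi>) x = (s / lam x) *\<^sub>R \<phi> x - g x"
    using eq H1(4) AE_space
  proof eventually_elim
    case (elim x)
    then have "0 < lam x"
      using lam_pos by simp
    moreover from elim have "weak_deriv (scaled lam \<psi>) x = s *\<^sub>R \<psi> x - g x"
      by (metis add_diff_cancel_left' diff_add_cancel op_A_adj_def)
    moreover have "\<phi> x = lam x *\<^sub>R \<psi> x"
      using elim by (simp add: scaled_def)
    ultimately show ?case
      by simp
  qed
  moreover have "(\<lambda>x. (s / lam x) *\<^sub>R \<phi> x - g x) \<in> borel_measurable unit_leb"
    by (rule L2_measurable[OF L2_diff[OF inv_lam_scaleR_L2[OF \<phi>L2] g]])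
  ultimately have "AC \<phi> (\<lambda>x. (s / lam x) *\<^sub>R \<phi> x - g x)"
    by (rule AC_AE_cong[OF H1(3)])
  from resolvent_AC_boundary[OF this] show ?thesis
    by (simp add: bc \<phi>_def[symmetric])
qed

text \<open>The rescaled trace satisfies
  \<open>y s = q s *\<^sub>R (ctranspose Ad *v y s) + J s\<close>. \<open>J s\<close> tends to
  \<open>h 0\<close> by \<open>laplace_tendsto\<close>; the other term is the contribution of the
  far end, damped by \<open>q s\<close>. Hence the limit sees \<open>h\<close> at 0 only.\<close>

lemma yosida_tendsto:
  fixes Ad :: "complex^'n^'n" and Bd :: "complex^'p^'n" and g h :: "real \<Rightarrow> complex^'n"
  assumes g: "g \<in> L2" and h: "continuous_on {0..1} h" and gh: "AE x in unit_leb. lam x *\<^sub>R g x = h x"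
  shows "(yosida_approx lam Ad Bd g \<longlongrightarrow> ctranspose Bd *v h 0) at_top"
proof -
  define q where "q = (\<lambda>s. exp (- s * travel 1))"
  define J where "J = (\<lambda>s. s *\<^sub>R integral {0..1} (\<lambda>x. exp (- s * travel x) *\<^sub>R g x))"
  obtain c where c: "c > 0" "\<And>x. norm (ctranspose Ad *v x) \<le> norm x * c"
    using bounded_linear.pos_bounded matrix_vector_mul_linear linear_conv_bounded_linear by blast
  have q: "(q \<longlongrightarrow> 0) at_top"
    unfolding q_def by (rule exp_travel_tendsto)
  have neg: "negligible {x \<in> {0..1}. lam x *\<^sub>R g x \<noteq> h x}"
    using gh by (auto simp: AE_restrict_space_iff negligible_iff_null_sets completion.AE_iff_null_sets)
  have J_eq: "J s = integral {0..1} (\<lambda>x. (s * exp (- s * travel x) * (1 / lam x)) *\<^sub>R h x)" for s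
  proof -
    have "J s = integral {0..1} (\<lambda>x. s *\<^sub>R (exp (- s * travel x) *\<^sub>R g x))"
      unfolding J_def by (rule integral_cmul[symmetric])
    also have "\<dots> = integral {0..1} (\<lambda>x. (s * exp (- s * travel x) * (1 / lam x)) *\<^sub>R h x)"
    proof (rule integral_spike[OF neg])
      fix x
      assume "x \<in> {0..1} - {x \<in> {0..1}. lam x *\<^sub>R g x \<noteq> h x}"
      then have "h x = lam x *\<^sub>R g x" "0 < lam x"
        using lam_pos by auto
      then show "(s * exp (- s * travel x) * (1 / lam x)) *\<^sub>R h x = s *\<^sub>R (exp (- s * travel x) *\<^sub>R g x)"
        by simp
    qed
    finally show ?thesis .
  qed
  have J: "(J \<longlongrightarrow> h 0) at_top"
    unfolding J_eq[abs_def] by (rule laplace_tendsto[OF h])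
  define y where "y = (\<lambda>s. s *\<^sub>R cont_rep (scaled lam (resolvent_A_adj lam Ad s g)) 0)"
  have "\<forall>\<^sub>F s in at_top. q s < 1 / (2 * c)"
    using q c(1) by (intro order_tendstoD(2)) auto
  then have ev: "\<forall>\<^sub>F s in at_top. yosida_approx lam Ad Bd g s = ctranspose Bd *v y s \<and> norm (y s - J s) \<le> 2 * c * q s * norm (J s)"
  proof eventually_elim
    case (elim s)
    have q0: "0 \<le> q s"
      by (simp add: q_def)
    have contr: "norm (q s *\<^sub>R (ctranspose Ad *v x)) \<le> q s * c * norm x" for x
      using mult_left_mono[OF c(2)[of x] q0] q0 by (simp add: mult_ac)
    \<comment> \<open>The threshold \<open>1 / (2 * c)\<close> for \<open>q s\<close> is chosen for
      this bound, which provides the contraction demanded by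
      \<open>resolvent_correct\<close>.\<close>
    have qc: "q s * c \<le> 1 / 2"
      using elim c(1) by (simp add: field_simps)
    have "norm (q s *\<^sub>R (ctranspose Ad *v x)) \<le> norm x / 2" for x
      using contr[of x] mult_right_mono[OF qc norm_ge_zero[of x]] by simp
    note res = resolvent_correct[OF g this[unfolded q_def]]
    let ?\<psi> = "resolvent_A_adj lam Ad s g"
    have u: "scaled lam ?\<psi> \<in> H1"
      using res(1) by (simp add: dom_A_adj_def)
    have "cont_rep (scaled lam (\<lambda>x. s *\<^sub>R ?\<psi> x)) 0 = s *\<^sub>R cont_rep (scaled lam ?\<psi>) 0"
    proof (rule cont_rep_eq)
      show "continuous_on {0..1} (\<lambda>x. s *\<^sub>R cont_rep (scaled lam ?\<psi>) x)"
        by (intro continuous_intros AC_continuous_on[OF H1_AC(3)[OF u]])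
      show "AE x in unit_leb. s *\<^sub>R cont_rep (scaled lam ?\<psi>) x = scaled lam (\<lambda>x. s *\<^sub>R ?\<psi> x) x"
        using H1_AC(4)[OF u] by eventually_elim (simp add: scaled_def mult.commute)
    qed simp
    then have yos: "yosida_approx lam Ad Bd g s = ctranspose Bd *v y s"
      by (simp add: yosida_approx_def op_B_adj_def y_def)
    have "y s = q s *\<^sub>R (ctranspose Ad *v y s) + J s"
      unfolding y_def J_def q_def
      by (subst resolvent_trace[OF g res]) (simp add: matrix_vector_scaleR scaleR_add_right mult.commute)
    then have eq: "y s - J s = q s *\<^sub>R (ctranspose Ad *v y s)"
      by (simp add: algebra_simps)
    then have diff: "norm (y s - J s) \<le> q s * c * norm (y s)"
      using contr[of "y s"] by simp
    \<comment> \<open>Absorption: the correction is at most half of \<open>norm (y s)\<close>, so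
      \<open>y s\<close> is controlled by \<open>J s\<close> before its own limit is known.\<close>
    have "norm (y s) \<le> norm (J s) + norm (y s - J s)"
      using norm_triangle_ineq[of "J s" "y s - J s"] by simp
    moreover have "q s * c * norm (y s) \<le> (1 / 2) * norm (y s)"
      by (rule mult_right_mono[OF qc norm_ge_zero])
    ultimately have "norm (y s) \<le> 2 * norm (J s)"
      using diff by simp
    then have "q s * c * norm (y s) \<le> q s * c * (2 * norm (J s))"
      using q0 c(1) by (intro mult_left_mono) auto
    with diff yos show ?case
      by (simp add: mult_ac)
  qed
  have "((\<lambda>s. 2 * c * q s * norm (J s)) \<longlongrightarrow> 2 * c * 0 * norm (h 0)) at_top"
    by (intro tendsto_intros q J)
  then have null: "((\<lambda>s. 2 * c * q s * norm (J s)) \<longlongrightarrow> 0) at_top"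
    by simp
  have "((\<lambda>s. y s - J s) \<longlongrightarrow> 0) at_top"
    by (rule Lim_null_comparison[OF eventually_mono[OF ev] null]) simp
  from tendsto_add[OF this J] have "(y \<longlongrightarrow> h 0) at_top"
    by simp
  then have "((\<lambda>s. ctranspose Bd *v y s) \<longlongrightarrow> ctranspose Bd *v h 0) at_top"
    by (rule bounded_linear.tendsto[OF linear_conv_bounded_linear[THEN iffD1, OF matrix_vector_mul_linear]])
  moreover have "\<forall>\<^sub>F s in at_top. ctranspose Bd *v y s = yosida_approx lam Ad Bd g s"
    using ev by eventually_elim simp
  ultimately show ?thesis
    by (rule Lim_transform_eventually)
qed

end

section \<open>The Riccati equation\<close>

lemma cinner_matrix_matrix: "cinner (M *v x) (N *v y) = cinner ((ctranspose N ** M) *v x) y"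
  by (simp add: cinner_matrix_left flip: matrix_vector_mul_assoc)

lemma cinner_diff_left: "cinner (x - x') y = cinner x y - cinner x' y"
  by (rule bounded_bilinear.diff_left[OF bounded_bilinear_cinner])

lemma cinner_add_left: "cinner (x + x') y = cinner x y + cinner x' y"
  by (rule bounded_bilinear.add_left[OF bounded_bilinear_cinner])

lemma borel_measurable_cinner:
  fixes f g :: "real \<Rightarrow> complex^'n"
  assumes "f \<in> borel_measurable M" "g \<in> borel_measurable M"
  shows "(\<lambda>x. cinner (f x) (g x)) \<in> borel_measurable M"
  using assms
  by (rule borel_measurable_continuous_Pair)
    (intro bounded_bilinear.continuous_on[OF bounded_bilinear_cinner] continuous_intros)

lemma borel_measurable_matrix_vector:
  fixes M :: "complex^'n^'m"
  assumes "f \<in> borel_measurable N"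
  shows "(\<lambda>x. M *v f x) \<in> borel_measurable N"
proof -
  have "(*v) M \<in> borel_measurable borel"
    by (intro borel_measurable_continuous_onI linear_continuous_on)
      (simp add: linear_conv_bounded_linear[symmetric])
  from measurable_compose[OF assms this] show ?thesis .
qed

lemma L2_matrix_vector:
  fixes M :: "complex^'n^'n"
  assumes "f \<in> L2"
  shows "(\<lambda>x. M *v f x) \<in> L2"
proof -
  obtain c where c: "\<And>x. norm (M *v x) \<le> norm x * c"
    using bounded_linear.pos_bounded matrix_vector_mul_linear linear_conv_bounded_linear by blast
  show ?thesis
  proof (rule L2_I_bound[OF _ assms])
    show "(\<lambda>x. M *v f x) \<in> borel_measurable unit_leb"
      by (rule borel_measurable_matrix_vector[OF L2_measurable[OF assms]])
    show "norm (M *v f x) \<le> c * norm (f x)" for x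
      using c[of "f x"] by (simp add: mult.commute)
  qed
qed

context weight
begin

text \<open>The weight in \<open>inner_X\<close> is shifted onto \<open>z\<close>, turning
  \<open>lam z\<close> into \<open>w\<close>; up to sign the two products become the two halves of
  the product rule for \<open>cinner (PI *v w x) (w x)\<close>. In the first, self-adjointness
  brings \<open>PI\<close> onto the derivative.\<close>

lemma energy_balance:
  fixes PI :: "complex^'n^'n" and z :: "real \<Rightarrow> complex^'n"
  assumes PI: "ctranspose PI = PI" and z: "z \<in> L2" and u: "scaled lam z \<in> H1"
  defines "w \<equiv> cont_rep (scaled lam z)"
  shows "inner_X lam (op_A lam z) (op_Z PI z) + inner_X lam (op_Z PI z) (op_A lam z)
    = cinner (PI *v w 0) (w 0) - cinner (PI *v w 1) (w 1)"
proof -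
  define v where "v = weak_deriv (scaled lam z)"
  note H1 = H1_AC[OF u, folded w_def v_def]
  have wL2: "w \<in> L2"
    by (rule L2_continuous[OF AC_continuous_on[OF H1(3)]])
  have PIw: "AC (\<lambda>x. PI *v w x) (\<lambda>x. PI *v v x)"
    by (rule AC_linear[OF H1(3) matrix_vector_mul_linear])
  have int1: "integrable unit_leb (\<lambda>x. cinner (PI *v v x) (w x))"
    using abs_integrable_continuous_bilinear[OF bounded_bilinear.flip[OF bounded_bilinear_cinner]
        AC_continuous_on[OF H1(3)] AC_integrable[OF PIw]]
    by (simp add: abs_integrable_on_iff_integrable)
  have int2: "integrable unit_leb (\<lambda>x. cinner (PI *v w x) (v x))"
    using abs_integrable_continuous_bilinear[OF bounded_bilinear_cinner
        AC_continuous_on[OF PIw] AC_integrable[OF H1(3)]]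
    by (simp add: abs_integrable_on_iff_integrable)
  note meas = borel_measurable_cinner borel_measurable_scaleR borel_measurable_uminus
    borel_measurable_matrix_vector lam_measurable L2_measurable[OF z] L2_measurable[OF H1(1)] L2_measurable[OF wL2]
  note sesq = bounded_bilinear.minus_left[OF bounded_bilinear_cinner] bounded_bilinear.minus_right[OF bounded_bilinear_cinner]
    bounded_bilinear.scaleR_left[OF bounded_bilinear_cinner] bounded_bilinear.scaleR_right[OF bounded_bilinear_cinner]
  have "inner_X lam (op_A lam z) (op_Z PI z) = (LINT x|unit_leb. - cinner (PI *v v x) (w x))"
    unfolding inner_X_def op_A_def op_Z_def v_def[symmetric]
  proof (rule integral_cong_AE)
    show "AE x in unit_leb. cinner (lam x *\<^sub>R - v x) (PI *v z x) = - cinner (PI *v v x) (w x)"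
      using H1(4)
    proof eventually_elim
      case (elim x)
      have "cinner (lam x *\<^sub>R - v x) (PI *v z x) = - cinner (v x) (PI *v (lam x *\<^sub>R z x))"
        by (simp add: sesq matrix_vector_scaleR)
      also have "\<dots> = - cinner (PI *v v x) (w x)"
        using elim by (simp add: cinner_matrix_left PI scaled_def)
      finally show ?case .
    qed
  qed (intro meas)+
  moreover have "inner_X lam (op_Z PI z) (op_A lam z) = (LINT x|unit_leb. - cinner (PI *v w x) (v x))"
    unfolding inner_X_def op_A_def op_Z_def v_def[symmetric]
  proof (rule integral_cong_AE)
    show "AE x in unit_leb. cinner (lam x *\<^sub>R (PI *v z x)) (- v x) = - cinner (PI *v w x) (v x)"
      using H1(4)
    proof eventually_elim
      case (elim x)
      then show ?case
        by (simp add: sesq matrix_vector_scaleR[symmetric] scaled_def)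
    qed
  qed (intro meas)+
  moreover have "cinner (PI *v w 1) (w 1) - cinner (PI *v w 0) (w 0)
      = integral {0..1} (\<lambda>x. cinner (PI *v v x) (w x) + cinner (PI *v w x) (v x))"
    by (rule AC_diff[OF AC_bilinear[OF bounded_bilinear_cinner PIw H1(3)]]) simp_all
  then have "cinner (PI *v w 1) (w 1) - cinner (PI *v w 0) (w 0)
      = (LINT x|unit_leb. cinner (PI *v v x) (w x)) + (LINT x|unit_leb. cinner (PI *v w x) (v x))"
    using int1 int2 lebesgue_integral_eq_integral[OF Bochner_Integration.integrable_add[OF int1 int2]] by simp
  ultimately show ?thesis
    by (simp add: algebra_simps)
qed

end

theorem theorem2:
  fixes lam :: "real \<Rightarrow> real" and \<epsilon> :: real
    and K L :: "complex^'n::{finite,linorder}^'n::{finite,linorder}"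
    and Ky Ly :: "complex^'n::{finite,linorder}^'m"
    and Ad PI :: "complex^'n::{finite,linorder}^'n::{finite,linorder}"
    and Bd :: "complex^'p::{finite,linorder}^'n::{finite,linorder}"
    and Cd :: "complex^'n::{finite,linorder}^'m"
    and Dd :: "complex^'p::{finite,linorder}^'m"
    and P \<Omega> :: "complex^'p::{finite,linorder}^'p::{finite,linorder}"
    and V :: "complex^'n::{finite,linorder}^'p::{finite,linorder}"
  assumes "CARD('p) \<le> CARD('n)"
    and "lam \<in> borel_measurable unit_leb" and "bounded (lam ` {0..1})"
    and "\<epsilon> > 0" and "\<forall>x\<in>{0..1}. lam x \<ge> \<epsilon>"
    and "invertible K"
    and "Ad = - (matrix_inv K ** L)"
    and "Bd = - (matrix_inv K ** zero_id)"
    and "Cd = Ky ** matrix_inv K ** L - Ly"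
    and "Dd = Ky ** matrix_inv K ** zero_id"
    and "psd PI"
    and "P = mat 1 + ctranspose Dd ** Dd + ctranspose Bd ** PI ** Bd"
    and "V = ctranspose Dd ** Cd + ctranspose Bd ** PI ** Ad"
    and "ctranspose Ad ** PI ** Ad - PI + ctranspose Cd ** Cd
           = ctranspose V ** matrix_inv P ** V"
    and "\<Omega> = psd_sqrt P"
  shows "\<forall>z\<in>dom_A lam Ad.
    op_Z PI z \<in> dom_B_omega_adj lam Ad Bd \<and>
    inner_X lam (op_A lam z) (op_Z PI z) + inner_X lam (op_Z PI z) (op_A lam z)
        + cinner (op_C lam Cd z) (op_C lam Cd z)
      = cinner
          (matrix_inv (ctranspose \<Omega> ** \<Omega>) *v
            (op_B_omega_adj lam Ad Bd (op_Z PI z) + ctranspose Dd *v op_C lam Cd z))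
          (op_B_omega_adj lam Ad Bd (op_Z PI z) + ctranspose Dd *v op_C lam Cd z)"
proof
  fix z
  assume z: "z \<in> dom_A lam Ad"
  obtain M where M: "\<And>x. x \<in> {0..1} \<Longrightarrow> lam x \<le> M"
    using assms(3) unfolding bounded_iff by (metis abs_le_D1 imageI real_norm_def)
  interpret weight lam \<epsilon> M
    using assms(2,4,5) M by unfold_locales auto
  define w where "w = cont_rep (scaled lam z)"
  have zL2: "z \<in> L2" and u: "scaled lam z \<in> H1" and bc: "w 0 = Ad *v w 1"
    using z by (auto simp: dom_A_def w_def)
  have PI: "ctranspose PI = PI"
    using \<open>psd PI\<close> by (simp add: psd_def)
  have ZL2: "op_Z PI z \<in> L2"
    unfolding op_Z_def by (rule L2_matrix_vector[OF zL2])
  have "continuous_on {0..1} (\<lambda>x. PI *v w x)"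
    unfolding w_def by (rule AC_continuous_on[OF AC_linear[OF H1_AC(3)[OF u] matrix_vector_mul_linear]])
  moreover have "AE x in unit_leb. lam x *\<^sub>R op_Z PI z x = PI *v w x"
    using H1_AC(4)[OF u] unfolding w_def[symmetric]
    by eventually_elim (simp add: op_Z_def scaled_def matrix_vector_scaleR)
  ultimately have lim: "(yosida_approx lam Ad Bd (op_Z PI z) \<longlongrightarrow> ctranspose Bd *v (PI *v w 0)) at_top"
    by (rule yosida_tendsto[OF ZL2])
  have dom: "op_Z PI z \<in> dom_B_omega_adj lam Ad Bd"
    unfolding dom_B_omega_adj_def using ZL2 lim by blast
  have "op_B_omega_adj lam Ad Bd (op_Z PI z) = ctranspose Bd *v (PI *v w 0)"
    unfolding op_B_omega_adj_def by (rule tendsto_Lim[OF trivial_limit_at_top_linorder lim])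
  \<comment> \<open>The boundary condition expresses both traces through \<open>w 1\<close>, and the
    resulting coefficient is \<open>V\<close>.\<close>
  then have V: "op_B_omega_adj lam Ad Bd (op_Z PI z) + ctranspose Dd *v op_C lam Cd z = V *v w 1"
    by (simp add: assms(13) bc op_C_def w_def[symmetric] matrix_vector_mult_add_rdistrib
        add.commute flip: matrix_vector_mul_assoc)
  \<comment> \<open>The inner \<open>mat 1\<close> brings \<open>ctranspose Dd ** Dd\<close> into
    the shape of \<open>psd_conj\<close>.\<close>
  have "psd (mat 1 + ctranspose Dd ** mat 1 ** Dd + ctranspose Bd ** PI ** Bd)"
    using \<open>psd PI\<close> by (intro psd_add psd_conj psd_mat_1)
  then have "psd P"
    by (simp add: assms(12))
  then have \<Omega>: "ctranspose \<Omega> ** \<Omega> = P"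
    using psd_sqrt_correct[of P] by (simp add: assms(15) psd_def)
  have "inner_X lam (op_A lam z) (op_Z PI z) + inner_X lam (op_Z PI z) (op_A lam z)
        + cinner (op_C lam Cd z) (op_C lam Cd z)
      = cinner (PI *v w 0) (w 0) - cinner (PI *v w 1) (w 1) + cinner (Cd *v w 1) (Cd *v w 1)"
    by (simp add: energy_balance[OF PI zL2 u] op_C_def w_def)
  also have "\<dots> = cinner ((ctranspose Ad ** PI ** Ad - PI + ctranspose Cd ** Cd) *v w 1) (w 1)"
    by (simp add: bc matrix_vector_mul_assoc cinner_matrix_matrix cinner_diff_left cinner_add_left
        matrix_vector_mult_add_rdistrib matrix_vector_mult_diff_rdistrib matrix_mul_assoc)
  \<comment> \<open>The matrix Riccati equation replaces the coefficient; its left factor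
    \<open>ctranspose V\<close> then moves to the second argument as \<open>V\<close>.\<close>
  also have "\<dots> = cinner (matrix_inv P *v (V *v w 1)) (V *v w 1)"
    by (simp add: assms(14) matrix_vector_mul_assoc cinner_matrix_matrix matrix_mul_assoc)
  finally show "op_Z PI z \<in> dom_B_omega_adj lam Ad Bd \<and>
    inner_X lam (op_A lam z) (op_Z PI z) + inner_X lam (op_Z PI z) (op_A lam z)
        + cinner (op_C lam Cd z) (op_C lam Cd z)
      = cinner
          (matrix_inv (ctranspose \<Omega> ** \<Omega>) *v
            (op_B_omega_adj lam Ad Bd (op_Z PI z) + ctranspose Dd *v op_C lam Cd z))
          (op_B_omega_adj lam Ad Bd (op_Z PI z) + ctranspose Dd *v op_C lam Cd z)"
    using dom by (simp add: V \<Omega>)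
qed

end
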